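(* Let $f\in L^1([-\pi,\pi])$ be real and even, and suppose that $m_f=\operatorname{ess\,inf}_{[0,\pi]}f>-\infty$ or $M_f=\operatorname{ess\,sup}_{[0,\pi]}f<\infty$. Then, for every $n$, there exist a real unitary matrix $V_n$ and an ordering of the eigenvalues $\lambda_1(T_n(f)),\ldots,\lambda_n(T_n(f))$ of $T_n(f)$ and $\lambda_1(H_n(f)),\ldots,\lambda_n(H_n(f))$ of $H_n(f)$ such that $$Y_n=V_n\Delta_nV_n^*,\qquad \Delta_n=\operatorname{diag}_{i=1,\ldots,n}(-1)^{i+1},$$ $$T_n(f)=V_nD_nV_n^*,\qquad D_n=\operatorname{diag}_{i=1,\ldots,n}\lambda_i(T_n(f)),$$ $$H_n(f)=V_nE_nV_n^*,\qquad E_n=\Delta_nD_n=\operatorname{diag}_{i=1,\ldots,n}\lambda_i(H_n(f)),$$ $$\lambda_i(H_n(f))=(-1)^{i+1}\lambda_i(T_n(f)),\qquad i=1,\ldots,n,$$ and such that $$\{\Lambda_n^+\}_n\sim f,\qquad \Lambda_n^+=\{\lambda_{2i-1}(H_n(f))\}_{i=1,\ldots,\lceil n/2\rceil}=\{\lambda_{2i-1}(T_n(f))\}_{i=1,\ldots,\lceil n/2\rceil},$$ $$\{\Lambda_n^-\}_n\sim -f,\qquad \Lambda_n^-=\{\lambda_{2i}(H_n(f))\}_{i=1,\ldots,\lfloor n/2\rfloor}=\{-\lambda_{2i}(T_n(f))\}_{i=1,\ldots,\lfloor n/2\rfloor}.$$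
   Context: For $f\in L^1([-\pi,\pi])$ the Fourier coefficients are $f_k=\frac1{2\pi}\int_{-\pi}^{\pi}f(x)e^{-\mathrm{i}kx}\,dx$, $k\in\mathbb Z$; $T_n(f)=[f_{i-j}]_{i,j=1}^n$ is the $n\times n$ Toeplitz matrix generated by $f$; $Y_n$ is the $n\times n$ exchange matrix, with entries $1$ on the main anti-diagonal ($i+j=n+1$) and $0$ elsewhere; $H_n(f)=Y_nT_n(f)$ is the flipped Toeplitz matrix generated by $f$. Eigenvalues are listed with multiplicity. "Even" means $f(-x)=f(x)$. The essential range of a measurable $f$ on a domain $\Omega$ is $\mathcal{ER}(f)=\{z\in\mathbb C:\ \mu\{|f-z|<\epsilon\}>0\text{ for all }\epsilon>0\}$ ($\mu$ is Lebesgue measure); for $f$ real a.e., $\operatorname{ess\,inf}_\Omega f=\inf\mathcal{ER}(f)$ and $\operatorname{ess\,sup}_\Omega f=\sup\mathcal{ER}(f)$, where the essential range is that of $f$ on $\Omega$. Asymptotic distribution: let $\{\Lambda_n=\{\lambda_{1,n},\ldots,\lambda_{d_n,n}\}\}_n$ be a sequence of finite multisets of numbers with $d_n\to\infty$, and let $g:\Omega\subset\mathbb R\to\mathbb C$ be measurable with $0<\mu(\Omega)<\infty$. One writes $\{\Lambda_n\}_n\sim g$ if $\lim_{n\to\infty}\frac1{d_n}\sum_{i=1}^{d_n}F(\lambda_{i,n})=\frac1{\mu(\Omega)}\int_\Omega F(g(x))\,dx$ for every continuous complex-valued $F$ with bounded support on $\mathbb C$. Here $f$ and $-f$ are regarded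 as functions on $\Omega=[-\pi,\pi]$. *)

theory Defs
  imports "HOL-Analysis.Analysis" "Jordan_Normal_Form.Schur_Decomposition"
begin

definition fourier_coeff :: "(real \<Rightarrow> complex) \<Rightarrow> int \<Rightarrow> complex" where
  "fourier_coeff f k =
     1 / (2 * of_real pi) *
     (LINT x|lebesgue_on {-pi..pi}. f x * exp (- \<i> * of_int k * of_real x))"

text \<open>Matrices are indexed from 0. The Toeplitz entries depend on the difference of the indices
  only; the main anti-diagonal, which is $i + j = n + 1$ for indices from 1, becomes
  $i + j + 1 = n$.\<close>

definition toeplitz_mat :: "nat \<Rightarrow> (real \<Rightarrow> complex) \<Rightarrow> complex mat" where
  "toeplitz_mat n f = mat n n (\<lambda>(i, j). fourier_coeff f (int i - int j))"

definition exchange_mat :: "nat \<Rightarrow> complex mat" where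
  "exchange_mat n = mat n n (\<lambda>(i, j). if i + j + 1 = n then 1 else 0)"

definition flipped_toeplitz_mat :: "nat \<Rightarrow> (real \<Rightarrow> complex) \<Rightarrow> complex mat" where
  "flipped_toeplitz_mat n f = exchange_mat n * toeplitz_mat n f"

definition real_unitary_mat :: "nat \<Rightarrow> complex mat \<Rightarrow> bool" where
  "real_unitary_mat n V \<longleftrightarrow>
     V \<in> carrier_mat n n \<and> elements_mat V \<subseteq> \<real> \<and>
     V * mat_adjoint V = 1\<^sub>m n \<and> mat_adjoint V * V = 1\<^sub>m n"

text \<open>Families of numbers $d_1, \ldots, d_n$ are indexed from 1.\<close>

definition diag_from_1 :: "nat \<Rightarrow> (nat \<Rightarrow> complex) \<Rightarrow> complex mat" where
  "diag_from_1 n d = mat_diag n (\<lambda>i. d (i + 1))"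

definition family_mset :: "nat \<Rightarrow> (nat \<Rightarrow> complex) \<Rightarrow> complex multiset" where
  "family_mset m d = image_mset d (mset_set {1..m})"

definition eigenvalues_mset :: "complex mat \<Rightarrow> complex multiset" where
  "eigenvalues_mset A = proots (char_poly A)"

definition eigenvalue_ordering :: "complex mat \<Rightarrow> (nat \<Rightarrow> complex) \<Rightarrow> bool" where
  "eigenvalue_ordering A l \<longleftrightarrow> family_mset (dim_row A) l = eigenvalues_mset A"

definition essential_range :: "real set \<Rightarrow> (real \<Rightarrow> complex) \<Rightarrow> complex set" where
  "essential_range \<Omega> f =
     {z. \<forall>\<epsilon>>0. emeasure lebesgue {x \<in> \<Omega>. cmod (f x - z) < \<epsilon>} > 0}"

text \<open>The next two are meant for functions that are real almost everywhere: their essential range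
  consists of real numbers, so that taking the real part loses nothing.\<close>

definition ess_inf_on :: "real set \<Rightarrow> (real \<Rightarrow> complex) \<Rightarrow> ereal" where
  "ess_inf_on \<Omega> f = (INF z\<in>essential_range \<Omega> f. ereal (Re z))"

definition ess_sup_on :: "real set \<Rightarrow> (real \<Rightarrow> complex) \<Rightarrow> ereal" where
  "ess_sup_on \<Omega> f = (SUP z\<in>essential_range \<Omega> f. ereal (Re z))"

definition asymp_distributed ::
    "(nat \<Rightarrow> complex multiset) \<Rightarrow> real set \<Rightarrow> (real \<Rightarrow> complex) \<Rightarrow> bool" where
  "asymp_distributed \<Lambda> \<Omega> g \<longleftrightarrow>
     filterlim (\<lambda>n. size (\<Lambda> n)) at_top sequentially \<and>
     \<Omega> \<in> sets lebesgue \<and> 0 < emeasure lebesgue \<Omega> \<and> emeasure lebesgue \<Omega> < \<infinity> \<and>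
     g \<in> borel_measurable (lebesgue_on \<Omega>) \<and>
     (\<forall>F :: complex \<Rightarrow> complex. continuous_on UNIV F \<and> bounded {z. F z \<noteq> 0} \<longrightarrow>
        (\<lambda>n. 1 / of_nat (size (\<Lambda> n)) * (\<Sum>z\<in>#\<Lambda> n. F z)) \<longlonglongrightarrow>
          1 / of_real (measure lebesgue \<Omega>) * (LINT x|lebesgue_on \<Omega>. F (g x)))"

end

(* Since f is even, T_n(f) is a real symmetric matrix that commutes with Y_n, so it can be
   diagonalized separately on the symmetric vectors (where Y_n = 1) and on the skew-symmetric ones
   (where Y_n = -1); alternating eigenvectors of the two kinds gives V_n.

   For the distribution it suffices to test with F(t) = |t - c|, because differences of such functions
   give the hat functions. Let e(x) = (exp(ijx))_j, let v_i be the eigenvectors of one parity, with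
   eigenvalues l_i, and W_i(x) = |<v_i, e(x)>|^2. Then 2 pi l_i is the integral of f W_i and 2 pi that
   of W_i, so
     - the integral of |f - c| W_i is at least 2 pi |l_i - c|, and
     - sum_i |l_i - c| W_i(x) >= |sum_i (l_i - c) W_i(x)|, where sum_i l_i W_i = <T_n(f) P e, P e> is
       close in L^1 to f sum_i W_i (P is the orthogonal projection onto the vectors of that parity).
   The error in the second step is bounded by the mean oscillation of f against the Fejer kernel,
   which is o(n) for integrable f. As sum_i W_i = |P e|^2 is asymptotically n/2, both bounds agree
   in the limit. *)

theory Submission
  imports Defs
begin

text \<open>Alternating the two kinds of vectors works because the symmetric ones have dimension
  ceil(n/2) and the skew-symmetric ones floor(n/2), which count the odd and the even positions in 1,
  ..., n. Projecting e(x) onto one parity makes |<P e(x), e(y)>|^2 peak at y = x and also at y = -x;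
  evenness of f folds the second peak onto the first. The kernel is unnormalized, with mass 2 pi n,
  so an L^1-small change of f costs a small multiple of n. For a function Lipschitz on the circle,
  the factor |exp(ix) - exp(iy)| absorbs one of the two Dirichlet sums in the kernel, which leaves
  O(sqrt n). Finally |P e(x)|^2 differs from n/2 by at most half the modulus of a Dirichlet sum at
  2x, which is bounded in n unless x is a multiple of pi.\<close>

section \<open>Joint eigenvectors of a centrosymmetric matrix and the flip\<close>

text \<open>Gaussian elimination, by induction on the equations: an equation with a nonzero
  coefficient is solved for that unknown, which removes one equation and one unknown. It serves
  below as the dimension count.\<close>

lemma homogeneous_system_nontrivial_solution:
  fixes a :: "'i \<Rightarrow> 'k \<Rightarrow> real"
  assumes "finite I" "finite S" "card I < card S"
  shows "\<exists>c. (\<exists>k\<in>S. c k \<noteq> 0) \<and> (\<forall>i\<in>I. (\<Sum>k\<in>S. a i k * c k) = 0)"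
  using assms
proof (induction I arbitrary: S a rule: finite_induct)
  case empty
  then obtain k where "k \<in> S" by fastforce
  then show ?case by (intro exI[of _ "\<lambda>_. 1"]) auto
next
  case (insert p I)
  show ?case
  proof (cases "\<forall>k\<in>S. a p k = 0")
    case True
    have "card I < card S" using insert by simp
    from insert.IH[OF insert.prems(1) this, of a] show ?thesis using True by auto
  next
    case False
    then obtain k0 where k0: "k0 \<in> S" "a p k0 \<noteq> 0" by auto
    define S' where "S' = S - {k0}"
    have S': "finite S'" "card I < card S'" "k0 \<notin> S'" "S = insert k0 S'"
      using insert k0 by (auto simp: S'_def)
    \<comment> \<open>These are the coefficients of the remaining equations once equation
      \<open>p\<close> has been used to substitute for the pivot unknown \<open>k0\<close>.\<close>
    from insert.IH[OF S'(1,2), of "\<lambda>i k. a i k - a i k0 * (a p k / a p k0)"]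
    obtain c where c: "\<exists>k\<in>S'. c k \<noteq> 0"
      "\<And>i. i \<in> I \<Longrightarrow> (\<Sum>k\<in>S'. (a i k - a i k0 * (a p k / a p k0)) * c k) = 0" by blast
    \<comment> \<open>The value that equation \<open>p\<close> forces on the pivot unknown.\<close>
    define r where "r = - (\<Sum>k\<in>S'. a p k * c k) / a p k0"
    define c' where "c' = c(k0 := r)"
    have eq: "(\<Sum>k\<in>S. a i k * c' k) = a i k0 * r + (\<Sum>k\<in>S'. a i k * c k)" for i
    proof -
      have "(\<Sum>k\<in>S'. a i k * c' k) = (\<Sum>k\<in>S'. a i k * c k)"
        using S' by (intro sum.cong) (auto simp: c'_def)
      then show ?thesis using S' by (simp add: c'_def)
    qed
    have "(\<Sum>k\<in>S. a p k * c' k) = 0"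
      using k0 by (simp add: eq r_def)
    moreover have "(\<Sum>k\<in>S. a i k * c' k) = 0" if "i \<in> I" for i
    proof -
      have "0 = (\<Sum>k\<in>S'. a i k * c k) - (\<Sum>k\<in>S'. a i k0 * (a p k / a p k0) * c k)"
        using c(2)[OF that] by (simp add: algebra_simps sum_subtractf)
      also have "(\<Sum>k\<in>S'. a i k0 * (a p k / a p k0) * c k) = - a i k0 * r"
        by (simp add: r_def sum_distrib_left mult_ac sum_divide_distrib sum_negf)
      finally show ?thesis by (simp add: eq)
    qed
    moreover have "\<exists>k\<in>S. c' k \<noteq> 0" using c(1) S' by (auto simp: c'_def)
    ultimately show ?thesis by blast
  qed
qed

text \<open>The eigenvector maximizes the Rayleigh quotient. The unit sphere of \<open>U\<close> is compact in the product
  topology because its elements are supported on \<open>{..<n}\<close>.\<close>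

lemma symmetric_eigenvector_in_subspace:
  fixes T :: "nat \<Rightarrow> nat \<Rightarrow> real" and U :: "(nat \<Rightarrow> real) set"
  assumes sym: "\<And>j k. j < n \<Longrightarrow> k < n \<Longrightarrow> T j k = T k j"
    and closed: "closed U"
    and supp: "\<And>w j. w \<in> U \<Longrightarrow> n \<le> j \<Longrightarrow> w j = 0"
    and lin: "\<And>w z c. w \<in> U \<Longrightarrow> z \<in> U \<Longrightarrow> (\<lambda>j. w j + c * z j) \<in> U"
    and inv: "\<And>w. w \<in> U \<Longrightarrow> (\<lambda>j. if j < n then \<Sum>k<n. T j k * w k else 0) \<in> U"
    and ex: "u \<in> U" "u \<noteq> (\<lambda>_. 0)"
  shows "\<exists>w\<in>U. \<exists>l. (\<Sum>j<n. w j * w j) = 1 \<and> (\<forall>j<n. (\<Sum>k<n. T j k * w k) = l * w j)"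
proof -
  define N where "N w z = (\<Sum>j<n. w j * z j)" for w z :: "nat \<Rightarrow> real"
  define A where "A w = (\<lambda>j. if j < n then \<Sum>k<n. T j k * w k else 0)" for w
  define Q where "Q w z = N w (A z)" for w z
  have Nlin: "N (\<lambda>j. w j + c * z j) y = N w y + c * N z y"
    "N y (\<lambda>j. w j + c * z j) = N y w + c * N y z" for w z y c
    by (simp_all add: N_def algebra_simps sum.distrib sum_distrib_left)
  have Alin: "A (\<lambda>j. w j + c * z j) = (\<lambda>j. A w j + c * A z j)" for w z c
    by (auto simp: A_def algebra_simps sum.distrib sum_distrib_left)
  have Qlin: "Q (\<lambda>j. w j + c * z j) y = Q w y + c * Q z y"
    "Q y (\<lambda>j. w j + c * z j) = Q y w + c * Q y z" for w z y c
    by (simp_all add: Q_def Alin Nlin)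
  have Qsym: "Q w z = Q z w" for w z
  proof -
    have "Q w z = (\<Sum>j<n. \<Sum>k<n. w j * (T j k * z k))"
      by (simp add: Q_def N_def A_def sum_distrib_left)
    also have "\<dots> = (\<Sum>k<n. \<Sum>j<n. z k * (T k j * w j))"
      by (subst sum.swap) (simp add: sym mult_ac)
    finally show ?thesis by (simp add: Q_def N_def A_def sum_distrib_left)
  qed
  have Nsym: "N w z = N z w" for w z by (simp add: N_def mult.commute)
  have Npos: "N w w > 0" if "w \<in> U" "w \<noteq> (\<lambda>_. 0)" for w
  proof -
    obtain j where j: "w j \<noteq> 0" using \<open>w \<noteq> _\<close> by auto
    then have "j < n" using supp[OF that(1)] by (meson not_less)
    then have "0 < w j * w j" "w j * w j \<le> N w w"
      using j by (auto simp: N_def zero_less_mult_iff intro!: member_le_sum)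
    then show ?thesis by linarith
  qed
  have zero: "(\<lambda>_. 0) \<in> U" using lin[OF ex(1) ex(1), of "-1"] by simp
  have scale: "(\<lambda>j. c * w j) \<in> U" if "w \<in> U" for w c using lin[OF zero that, of c] by simp
  \<comment> \<open>A product of compact sets. Unit vectors of \<open>U\<close> lie in it, since no
    coordinate of a unit vector exceeds 1 in modulus.\<close>
  define B where "B = PiE UNIV (\<lambda>j. if j < n then {-1..1} else {0::real})"
  have B: "compact B"
  proof -
    have "compactin (product_topology (\<lambda>i::nat. euclidean) UNIV) B"
      unfolding B_def compactin_PiE by auto
    then show ?thesis by (simp add: euclidean_product_topology)
  qed
  define K where "K = U \<inter> {w. N w w = 1} \<inter> B"
  have cN: "continuous_on UNIV (\<lambda>w. N w w)" "continuous_on UNIV (\<lambda>w. Q w w)"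
  proof -
    have Q: "Q w w = (\<Sum>j<n. w j * (\<Sum>k<n. T j k * w k))" for w
      by (simp add: Q_def N_def A_def)
    show "continuous_on UNIV (\<lambda>w. N w w)" unfolding N_def
      by (intro continuous_intros continuous_on_product_coordinates)
    show "continuous_on UNIV (\<lambda>w. Q w w)" unfolding Q
      by (intro continuous_intros continuous_on_product_coordinates)
  qed
  have "compact K" unfolding K_def
    using B closed closed_Collect_eq[OF cN(1) continuous_on_const[of _ 1]]
    by (intro closed_Int_compact closed_Int) auto
  moreover have inK: "w \<in> K" if "w \<in> U" "N w w = 1" for w
  proof -
    have "\<bar>w j\<bar> \<le> 1" if "j < n" for j
    proof -
      have "w j * w j \<le> N w w" unfolding N_def using that by (intro member_le_sum) auto
      then have "(w j)\<^sup>2 \<le> 1" using \<open>N w w = 1\<close> by (simp add: power2_eq_square)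
      then show ?thesis by (simp add: abs_square_le_1)
    qed
    then have "w \<in> B" using supp[OF that(1)] by (auto simp: B_def abs_le_iff minus_le_iff)
    then show ?thesis using that by (simp add: K_def)
  qed
  have unit: "(\<lambda>j. (1 / sqrt (N z z)) * z j) \<in> K" if "z \<in> U" "z \<noteq> (\<lambda>_. 0)" for z
  proof (rule inK[OF scale[OF that(1)]])
    have "N (\<lambda>j. c * z j) (\<lambda>j. c * z j) = c\<^sup>2 * N z z" for c
      by (simp add: N_def sum_distrib_left power2_eq_square mult_ac)
    from this[of "1 / sqrt (N z z)"] show "N (\<lambda>j. (1 / sqrt (N z z)) * z j) (\<lambda>j. (1 / sqrt (N z z)) * z j) = 1"
      using Npos[OF that] by (simp add: power_divide)
  qed
  ultimately obtain w where w: "w \<in> K" and max: "\<And>z. z \<in> K \<Longrightarrow> Q z z \<le> Q w w"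
    using continuous_attains_sup[of K "\<lambda>w. Q w w"] unit[OF ex] continuous_on_subset[OF cN(2), of K]
    by blast
  have wU: "w \<in> U" and wN: "N w w = 1" using w by (auto simp: K_def)
  define l where "l = Q w w"
  have pos: "Q z z \<le> l * N z z" if "z \<in> U" for z
  proof (cases "z = (\<lambda>_. 0)")
    case True then show ?thesis by (simp add: Q_def N_def)
  next
    case False
    have "Q (\<lambda>j. c * z j) (\<lambda>j. c * z j) = c\<^sup>2 * Q z z" for c
      using Qlin(1)[of "\<lambda>_. 0" c z] Qlin(2)[of _ "\<lambda>_. 0" c z]
      by (simp add: Q_def N_def A_def power2_eq_square)
    from max[OF unit[OF that False], unfolded this] Npos[OF that False]
    show ?thesis by (simp add: l_def power_divide field_simps)
  qed
  \<comment> \<open>First-order condition at the maximizer: along w + c z the gap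
    \<open>l * N - Q\<close> is a nonnegative quadratic in \<open>c\<close> that vanishes at c = 0,
    so its linear coefficient is 0.\<close>
  have orth: "Q z w = l * N z w" if z: "z \<in> U" for z
  proof (rule ccontr)
    assume ne: "Q z w \<noteq> l * N z w"
    define b where "b = l * N z w - Q z w"
    define a where "a = l * N z z - Q z z"
    have a: "a \<ge> 0" using pos[OF z] by (simp add: a_def)
    have ineq: "0 \<le> 2 * c * b + c\<^sup>2 * a" for c
      using pos[OF lin[OF wU z, of c]] wN
      by (simp add: Qlin Nlin a_def b_def l_def Qsym[of w z] Nsym[of w z] algebra_simps power2_eq_square)
    \<comment> \<open>The quadratic is smallest at -b/a; the 1 added to the denominator covers a = 0
      and still gives a negative value.\<close>
    define c where "c = - b / (a + 1)"
    have b: "b = - c * (a + 1)" and "c \<noteq> 0" using a ne by (auto simp: c_def b_def)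
    have "0 \<le> 2 * c * b + c\<^sup>2 * a" by (rule ineq)
    also have "\<dots> = - (c\<^sup>2 * (a + 2))" unfolding b by (simp add: algebra_simps power2_eq_square)
    also have "\<dots> < 0" using a \<open>c \<noteq> 0\<close> by simp
    finally show False by simp
  qed
  \<comment> \<open>The residual of the eigenvalue equation lies in \<open>U\<close>, so
    \<open>orth\<close> applies to it and shows that its norm is 0.\<close>
  define z where "z = (\<lambda>j. A w j + (- l) * w j)"
  have zU: "z \<in> U" unfolding z_def using inv[OF wU] wU by (intro lin) (auto simp: A_def)
  have "N z z = Q z w - l * N z w"
    using Nlin(2)[of z "A w" "- l" w] by (simp add: Q_def z_def)
  then have "N z z = 0" using orth[OF zU] by simp
  then have "z = (\<lambda>_. 0)" using Npos[OF zU] by fastforce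
  then have "A w j = l * w j" for j by (simp add: z_def fun_eq_iff)
  then have "(\<Sum>k<n. T j k * w k) = l * w j" if "j < n" for j
    using that by (metis (no_types, lifting) A_def)
  then show ?thesis using wU wN by (auto simp: N_def)
qed

text \<open>The next vector is sought among those of parity (-1)^m that are orthogonal to the
  earlier ones. Vectors of opposite parity are orthogonal anyway, so at most m div 2 conditions
  remain, fewer than the dimension of the parity class as long as m < n. This space is invariant
  under \<open>T\<close>: symmetry preserves orthogonality to eigenvectors, and centrosymmetry
  preserves parity.\<close>

lemma parity_eigenbasis_partial:
  fixes T :: "nat \<Rightarrow> nat \<Rightarrow> real"
  assumes sym: "\<And>j k. j < n \<Longrightarrow> k < n \<Longrightarrow> T j k = T k j"
    and centro: "\<And>j k. j < n \<Longrightarrow> k < n \<Longrightarrow> T (n - 1 - j) (n - 1 - k) = T j k"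
  shows "m \<le> n \<Longrightarrow> \<exists>(v :: nat \<Rightarrow> nat \<Rightarrow> real) l.
      (\<forall>i<m. \<forall>k<m. (\<Sum>j<n. v i j * v k j) = (if i = k then 1 else 0)) \<and>
      (\<forall>i<m. \<forall>j<n. (\<Sum>k<n. T j k * v i k) = l i * v i j) \<and>
      (\<forall>i<m. \<forall>j<n. v i (n - 1 - j) = (-1) ^ i * v i j)"
proof (induction m)
  case 0 then show ?case by auto
next
  case (Suc m)
  from Suc.IH[OF Suc_leD[OF Suc.prems]] obtain v l where
    on': "\<forall>i<m. \<forall>k<m. (\<Sum>j<n. v i j * v k j) = (if i = k then 1 else 0)" and
    ev': "\<forall>i<m. \<forall>j<n. (\<Sum>k<n. T j k * v i k) = l i * v i j" and
    par': "\<forall>i<m. \<forall>j<n. v i (n - 1 - j) = (-1) ^ i * v i j"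
    by blast
  note on = on'[rule_format] and ev = ev'[rule_format] and par = par'[rule_format]
  have mn: "m < n" using Suc by simp
  have flip_sum: "(\<Sum>j<n. F (n - 1 - j)) = (\<Sum>j<n. F j)" for F :: "nat \<Rightarrow> real"
    using sum.nat_diff_reindex[of F n] by simp
  define s :: real where "s = (-1) ^ m"
  have ss: "s * s = 1" by (simp add: s_def flip: power_mult_distrib)
  define U where "U = {w :: nat \<Rightarrow> real. (\<forall>j\<ge>n. w j = 0) \<and> (\<forall>i<m. (\<Sum>j<n. v i j * w j) = 0) \<and>
      (\<forall>j<n. w (n - 1 - j) = s * w j)}"
  have "\<exists>w\<in>U. \<exists>l. (\<Sum>j<n. w j * w j) = 1 \<and> (\<forall>j<n. (\<Sum>k<n. T j k * w k) = l * w j)"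
  proof -
    define I where "I = {i. i < m \<and> i mod 2 = m mod 2}"
    \<comment> \<open>The free coordinates of a vector of this parity: the first half, together with
      the middle one exactly when \<open>n\<close> is odd and \<open>m\<close> is even. A
      skew-symmetric vector vanishes in the middle.\<close>
    define S where "S = {..<(n + 1 - m mod 2) div 2}"
    have "card I \<le> card {..<m div 2}"
    proof (rule card_inj_on_le)
      show "inj_on (\<lambda>i. i div 2) I"
        by (auto simp: I_def inj_on_def) (metis div_mult_mod_eq)
      show "(\<lambda>i. i div 2) ` I \<subseteq> {..<m div 2}" unfolding I_def by auto presburger
    qed auto
    moreover have "m div 2 < (n + 1 - m mod 2) div 2" using mn by presburger
    ultimately have "card I < card S" by (simp add: S_def)
    moreover have "finite I" "finite S" by (auto simp: I_def S_def)
    ultimately obtain c where c: "\<exists>k\<in>S. c k \<noteq> 0"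
      "\<And>i. i \<in> I \<Longrightarrow> (\<Sum>k\<in>S. (v i k + s * v i (n - 1 - k)) * c k) = 0"
      using homogeneous_system_nontrivial_solution[of I S "\<lambda>i k. v i k + s * v i (n - 1 - k)"] by blast
    define c' where "c' k = (if k \<in> S then c k else 0)" for k
    \<comment> \<open>The free coordinates plus \<open>s\<close> times their reflection. Its inner
      product with \<open>v i\<close> is the left-hand side of equation \<open>i\<close> of the
      system just solved.\<close>
    define u where "u j = (if j < n then c' j + s * c' (n - 1 - j) else 0)" for j
    have Sn: "S \<subseteq> {..<n}" by (auto simp: S_def)
    have u_par: "u (n - 1 - j) = s * u j" if "j < n" for j
      using that ss by (simp add: u_def algebra_simps)
    have "(\<Sum>j<n. v i j * u j) = 0" if "i < m" for i
    proof (cases "i \<in> I")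
      case True
      have "(\<Sum>j<n. v i j * u j) = (\<Sum>j<n. v i j * c' j) + s * (\<Sum>j<n. v i j * c' (n - 1 - j))"
        by (simp add: u_def algebra_simps sum.distrib sum_distrib_left)
      also have "(\<Sum>j<n. v i j * c' (n - 1 - j)) = (\<Sum>j<n. v i (n - 1 - j) * c' j)"
        using flip_sum[of "\<lambda>j. v i (n - 1 - j) * c' j"] by simp
      also have "(\<Sum>j<n. v i j * c' j) + s * (\<Sum>j<n. v i (n - 1 - j) * c' j) =
          (\<Sum>j<n. (v i j + s * v i (n - 1 - j)) * c' j)"
        by (simp add: algebra_simps sum.distrib sum_distrib_left)
      also have "\<dots> = (\<Sum>j\<in>S. (v i j + s * v i (n - 1 - j)) * c j)"
        using Sn by (intro sum.mono_neutral_cong_right) (auto simp: c'_def)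
      finally show ?thesis using c(2)[OF True] by simp
    next
      case False
      then have i: "(-1) ^ i = - s" using that by (auto simp: I_def s_def minus_one_power_iff) presburger+
      have "(\<Sum>j<n. v i j * u j) = (\<Sum>j<n. v i (n - 1 - j) * u (n - 1 - j))"
        using flip_sum[of "\<lambda>j. v i j * u j"] by simp
      also have "\<dots> = (\<Sum>j<n. - ((s * s) * (v i j * u j)))"
      proof (intro sum.cong refl)
        fix x assume "x \<in> {..<n}"
        then have x: "x < n" by simp
        show "v i (n - 1 - x) * u (n - 1 - x) = - ((s * s) * (v i x * u x))"
          unfolding par[OF that x] u_par[OF x] i by simp
      qed
      finally show ?thesis using ss by (simp add: sum_negf)
    qed
    then have uU: "u \<in> U" using u_par by (auto simp: U_def u_def)
    obtain k where k: "k \<in> S" "c k \<noteq> 0" using c by auto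
    \<comment> \<open>\<open>k\<close> and its mirror image both lie in \<open>S\<close> only for
      the middle coordinate and s = 1; there the two contributions are equal and add up instead of
      cancelling.\<close>
    have "u k \<noteq> 0"
    proof (cases "n - 1 - k \<in> S")
      case True
      then have "m mod 2 = 0" "n - 1 - k = k" using k(1) mn unfolding S_def by (auto; presburger)+
      then have "s = 1" by (auto simp: s_def minus_one_power_iff)
      then show ?thesis using k Sn \<open>n - 1 - k = k\<close> by (auto simp: u_def c'_def)
    next
      case False
      then show ?thesis using k Sn by (auto simp: u_def c'_def)
    qed
    then have u0: "u \<noteq> (\<lambda>_. 0)" by auto
    show ?thesis
    proof (rule symmetric_eigenvector_in_subspace[OF sym _ _ _ _ uU u0])
      show "closed U" unfolding U_def
        by (intro closed_Collect_conj closed_Collect_all closed_Collect_imp closed_Collect_eq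
            continuous_intros continuous_on_product_coordinates) auto
      fix w assume w: "w \<in> U"
      show "(\<lambda>j. w j + c * z j) \<in> U" if "z \<in> U" for z c
        using w that by (auto simp: U_def algebra_simps sum.distrib simp flip: sum_distrib_left)
      show "(\<lambda>j. if j < n then \<Sum>k<n. T j k * w k else 0) \<in> U"
      proof -
        have "(\<Sum>j<n. v i j * (\<Sum>k<n. T j k * w k)) = 0" if i: "i < m" for i
        proof -
          have "(\<Sum>j<n. v i j * (\<Sum>k<n. T j k * w k)) = (\<Sum>k<n. (\<Sum>j<n. T k j * v i j) * w k)"
            by (simp add: sum_distrib_left sum_distrib_right, subst sum.swap) (simp add: sym mult_ac)
          also have "\<dots> = l i * (\<Sum>k<n. v i k * w k)" by (simp add: ev[OF i] sum_distrib_left mult_ac)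
          finally show ?thesis using w i by (simp add: U_def)
        qed
        moreover have "(\<Sum>k<n. T (n - 1 - j) k * w k) = s * (\<Sum>k<n. T j k * w k)" if j: "j < n" for j
        proof -
          have "(\<Sum>k<n. T (n - 1 - j) k * w k) = (\<Sum>k<n. T (n - 1 - j) (n - 1 - k) * w (n - 1 - k))"
            using flip_sum[of "\<lambda>k. T (n - 1 - j) k * w k"] by simp
          also have "\<dots> = (\<Sum>k<n. T j k * (s * w k))"
            using centro[OF j] w by (intro sum.cong) (auto simp: U_def)
          finally show ?thesis by (simp add: sum_distrib_left mult_ac)
        qed
        ultimately show ?thesis by (auto simp: U_def)
      qed
    qed (auto simp: U_def)
  qed
  then obtain w l' where w: "w \<in> U" "(\<Sum>j<n. w j * w j) = 1"
    "\<And>j. j < n \<Longrightarrow> (\<Sum>k<n. T j k * w k) = l' * w j" by blast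
  have wo: "(\<Sum>j<n. v i j * w j) = 0" "(\<Sum>j<n. w j * v i j) = 0" if "i < m" for i
    using w(1) that by (auto simp: U_def mult.commute)
  have wp: "w (n - 1 - j) = s * w j" if "j < n" for j using w(1) that by (auto simp: U_def)
  show ?case
    by (intro exI[of _ "v(m := w)"] exI[of _ "l(m := l')"])
      (use wp par in \<open>auto simp: less_Suc_eq on ev par w wo s_def\<close>)
qed

lemmas parity_eigenbasis = parity_eigenbasis_partial[OF _ _ order.refl]

section \<open>Quadratic forms in the exponentials\<close>

abbreviation circle_lebesgue :: "real measure" where
  "circle_lebesgue \<equiv> lebesgue_on {-pi..pi}"

lemma finite_measure_circle: "finite_measure circle_lebesgue"
  by (rule finite_measureI) (simp add: emeasure_restrict_space)

interpretation circle: finite_measure circle_lebesgue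
  by (rule finite_measure_circle)

interpretation circle_pair: pair_sigma_finite circle_lebesgue circle_lebesgue ..

lemma measure_circle: "measure circle_lebesgue {-pi..pi} = 2 * pi"
  by (simp add: measure_restrict_space)

lemma continuous_measurable_circle:
  fixes h :: "real \<Rightarrow> 'b::euclidean_space"
  shows "continuous_on UNIV h \<Longrightarrow> h \<in> borel_measurable circle_lebesgue"
  by (metis continuous_imp_measurable_on_sets_lebesgue continuous_on_subset lmeasurable_interval(1)
      fmeasurableD subset_UNIV)

lemma continuous_integrable_circle:
  fixes h :: "real \<Rightarrow> 'b::euclidean_space"
  shows "continuous_on UNIV h \<Longrightarrow> integrable circle_lebesgue h"
  by (meson continuous_imp_integrable_real continuous_on_subset subset_UNIV)

lemma integrable_mult_bounded:
  fixes g h :: "'a \<Rightarrow> 'b::{real_normed_field, banach, second_countable_topology}"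
  assumes "integrable M g" "h \<in> borel_measurable M" "\<And>x. norm (h x) \<le> B"
  shows "integrable M (\<lambda>x. g x * h x)"
proof (rule Bochner_Integration.integrable_bound[where f = "\<lambda>x. B * norm (g x)"])
  show "integrable M (\<lambda>x. B * norm (g x))" using assms(1) by simp
  show "(\<lambda>x. g x * h x) \<in> borel_measurable M" using assms(1,2) by measurable
  have "norm (g x * h x) \<le> norm (B * norm (g x))" for x
    using mult_left_mono[OF assms(3)[of x], of "norm (g x)"] order_trans[OF norm_ge_zero assms(3)]
    by (simp add: norm_mult abs_mult mult.commute)
  then show "AE x in M. norm (g x * h x) \<le> norm (B * norm (g x))" by simp
qed

lemma continuous_on_cis_compose [continuous_intros]:
  "continuous_on S h \<Longrightarrow> continuous_on S (\<lambda>x. cis (h x))"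
  using continuous_on_compose2[OF continuous_on_cis[of UNIV id]] by (auto simp: continuous_on_id)

lemma integral_cis_int:
  "(LINT x|circle_lebesgue. cis (of_int k * x)) = (if k = 0 then 2 * pi else 0)"
proof (cases "k = 0")
  case True
  then show ?thesis using measure_circle by (simp add: scaleR_conv_of_real space_restrict_space)
next
  case False
  define F where "F x = cis (of_int k * x) / (\<i> * of_int k)" for x :: real
  have "((\<lambda>x. cis (of_int k * x)) has_integral (F pi - F (- pi))) {-pi..pi}"
  proof (rule fundamental_theorem_of_calculus)
    fix x assume "x \<in> {-pi..pi}"
    have "((\<lambda>z. exp (\<i> * of_int k * z)) has_field_derivative exp (\<i> * of_int k * of_real x) * (\<i> * of_int k))
      (at (of_real x))" by (auto intro!: derivative_eq_intros)
    then have "((\<lambda>z. exp (\<i> * of_int k * z) / (\<i> * of_int k)) has_field_derivative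
        exp (\<i> * of_int k * of_real x)) (at (of_real x))"
      using False DERIV_cdivide[of _ _ _ _ "\<i> * of_int k"] by fastforce
    from has_vector_derivative_real_field[OF this, of "{-pi..pi}"]
    show "(F has_vector_derivative cis (of_int k * x)) (at x within {-pi..pi})"
      by (simp add: F_def[abs_def] cis_conv_exp mult_ac fun_eq_iff)
  qed simp
  moreover have "F pi = F (- pi)"
  proof -
    have "cis (of_int k * pi) = cis (of_int k * (- pi)) * cis (2 * pi * of_int k)"
      by (simp add: cis_mult algebra_simps)
    then show ?thesis by (simp add: F_def cis_multiple_2pi)
  qed
  ultimately have "integral {-pi..pi} (\<lambda>x. cis (of_int k * x)) = 0"
    by (simp add: integral_unique)
  then show ?thesis using False
    by (subst lebesgue_integral_eq_integral)
       (auto intro!: continuous_integrable_circle continuous_intros)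
qed

text \<open>Telescoping of the geometric sum. The product form replaces the usual bound 2 / |1 - z|
  and remains valid where cis x = cis y.\<close>

lemma cis_diff_mult_sum_le: "cmod (cis x - cis y) * cmod (\<Sum>j<n. cis (real j * (x - y))) \<le> 2"
proof -
  have "cmod (cis x - cis y) = cmod (cis y) * cmod (1 - cis (x - y))"
    by (simp only: norm_mult[symmetric]) (simp add: algebra_simps cis_mult norm_minus_commute)
  moreover have "(1 - cis (x - y)) * (\<Sum>j<n. cis (real j * (x - y))) = 1 - cis (real n * (x - y))"
    using one_diff_power_eq[of "cis (x - y)" n, symmetric] by (simp only: Complex.DeMoivre[symmetric])
  ultimately have "cmod (cis x - cis y) * cmod (\<Sum>j<n. cis (real j * (x - y))) =
      cmod (1 - cis (real n * (x - y)))"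
    by (simp flip: norm_mult)
  also have "\<dots> \<le> 2" using norm_triangle_ineq4[of 1 "cis (real n * (x - y))"] by simp
  finally show ?thesis .
qed

text \<open>The squared Dirichlet sum, which is \<open>n\<close> times the usual Fejer
  kernel.\<close>

definition fejer :: "nat \<Rightarrow> real \<Rightarrow> real" where
  "fejer n t = (cmod (\<Sum>j<n. cis (real j * t)))\<^sup>2"

lemma fejer_nonneg: "0 \<le> fejer n t" by (simp add: fejer_def)

lemma fejer_le: "fejer n t \<le> (real n)\<^sup>2"
proof -
  have "cmod (\<Sum>j<n. cis (real j * t)) \<le> (\<Sum>j<n. 1)" by (rule order_trans[OF norm_sum]) simp
  then show ?thesis unfolding fejer_def by (intro power_mono) auto
qed

lemma continuous_on_fejer [continuous_intros]:
  "continuous_on S h \<Longrightarrow> continuous_on S (\<lambda>x. fejer n (h x))"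
  unfolding fejer_def by (intro continuous_intros)

lemma fejer_minus: "fejer n (- t) = fejer n t"
proof -
  have "(\<Sum>j<n. cis (real j * (- t))) = cnj (\<Sum>j<n. cis (real j * t))" by (simp add: cis_cnj)
  then show ?thesis by (simp only: fejer_def complex_mod_cnj)
qed

lemma of_real_cmod_sum_squared:
  "complex_of_real ((cmod (\<Sum>j\<in>S. a j))\<^sup>2) = (\<Sum>j\<in>S. \<Sum>k\<in>S. a j * cnj (a k))"
  by (simp only: complex_norm_square cnj_sum sum_product)

text \<open>Expanding the square turns the integral into the Hermitian form of the Toeplitz matrix
  of \<open>h\<close> at \<open>p\<close>, and \<open>coeff\<close> supplies a decomposition of that
  matrix into rank-one terms. Leaving \<open>h\<close>, \<open>\<theta>\<close> and \<open>v\<close>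
  free covers the matrix of \<open>g\<close> as well as the identity matrix, which belongs to h =
  1.\<close>

lemma integral_quadratic_form:
  fixes h :: "real \<Rightarrow> real" and p :: "nat \<Rightarrow> complex"
  assumes h: "integrable circle_lebesgue h"
    and coeff: "\<And>j k. j < n \<Longrightarrow> k < n \<Longrightarrow>
      (LINT y|circle_lebesgue. of_real (h y) * cis (of_int (int k - int j) * y)) =
        of_real (2 * pi * (\<Sum>i<m. \<theta> i * v i j * v i k))"
  shows "(LINT y|circle_lebesgue. h y * (cmod (\<Sum>j<n. p j * cis (- (real j * y))))\<^sup>2) =
      2 * pi * (\<Sum>i<m. \<theta> i * (cmod (\<Sum>j<n. of_real (v i j) * p j))\<^sup>2)" (is "?L = ?R")
proof -
  have int: "integrable circle_lebesgue (\<lambda>y. of_real (h y) * cis (of_int k * y))" for k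
    by (rule integrable_mult_bounded[where B = 1])
      (auto intro!: h continuous_measurable_circle continuous_intros)
  have pt: "complex_of_real (h y * (cmod (\<Sum>j<n. p j * cis (- (real j * y))))\<^sup>2) =
      (\<Sum>j<n. \<Sum>k<n. p j * cnj (p k) * (of_real (h y) * cis (of_int (int k - int j) * y)))" for y
    unfolding of_real_mult of_real_cmod_sum_squared sum_distrib_left
    by (intro sum.cong refl) (simp add: cis_cnj mult_ac cis_mult algebra_simps)
  have "complex_of_real ?L =
      (LINT y|circle_lebesgue. complex_of_real (h y * (cmod (\<Sum>j<n. p j * cis (- (real j * y))))\<^sup>2))"
    by (simp only: integral_complex_of_real)
  also have "\<dots> = (\<Sum>j<n. \<Sum>k<n. p j * cnj (p k) *
      (LINT y|circle_lebesgue. of_real (h y) * cis (of_int (int k - int j) * y)))"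
    unfolding pt using int by (simp add: Bochner_Integration.integral_sum del: of_int_diff)
  also have "\<dots> = (\<Sum>j<n. \<Sum>k<n. p j * cnj (p k) * of_real (2 * pi * (\<Sum>i<m. \<theta> i * v i j * v i k)))"
    by (intro sum.cong refl) (simp only: coeff lessThan_iff)
  also have "\<dots> = (\<Sum>j<n. \<Sum>k<n. \<Sum>i<m. complex_of_real (2 * pi * \<theta> i) * ((v i j * p j) * cnj (v i k * p k)))"
    by (simp add: sum_distrib_left mult_ac)
  also have "\<dots> = (\<Sum>j<n. \<Sum>i<m. \<Sum>k<n. complex_of_real (2 * pi * \<theta> i) * ((v i j * p j) * cnj (v i k * p k)))"
    by (intro sum.cong refl sum.swap)
  also have "\<dots> = (\<Sum>i<m. \<Sum>j<n. \<Sum>k<n. complex_of_real (2 * pi * \<theta> i) * ((v i j * p j) * cnj (v i k * p k)))"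
    by (rule sum.swap)
  also have "\<dots> = (\<Sum>i<m. complex_of_real (2 * pi * \<theta> i) * complex_of_real ((cmod (\<Sum>j<n. of_real (v i j) * p j))\<^sup>2))"
    unfolding of_real_cmod_sum_squared sum_distrib_left ..
  also have "\<dots> = of_real ?R" by (simp add: sum_distrib_left mult_ac)
  finally show ?thesis using of_real_eq_iff by blast
qed

lemma integral_identity_quadratic_form:
  fixes p :: "nat \<Rightarrow> complex"
  shows "(LINT y|circle_lebesgue. (cmod (\<Sum>j<n. p j * cis (- (real j * y))))\<^sup>2) =
      2 * pi * (\<Sum>i<n. (cmod (p i))\<^sup>2)"
proof -
  \<comment> \<open>The standard basis, which makes the general formula into Parseval's
    identity.\<close>
  define v :: "nat \<Rightarrow> nat \<Rightarrow> real" where "v i j = (if i = j then 1 else 0)" for i j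
  have "(LINT y|circle_lebesgue. 1 * (cmod (\<Sum>j<n. p j * cis (- (real j * y))))\<^sup>2) =
      2 * pi * (\<Sum>i<n. 1 * (cmod (\<Sum>j<n. of_real (v i j) * p j))\<^sup>2)"
  proof (rule integral_quadratic_form)
    fix j k assume "j < n" "k < n"
    then show "(LINT y|circle_lebesgue. of_real 1 * cis (of_int (int k - int j) * y)) =
        of_real (2 * pi * (\<Sum>i<n. 1 * v i j * v i k))"
      unfolding of_real_1 mult_1 integral_cis_int
      by (auto simp: v_def if_distrib[of "\<lambda>x. x * _"] cong: if_cong)
  qed simp
  also have "(\<Sum>i<n. 1 * (cmod (\<Sum>j<n. of_real (v i j) * p j))\<^sup>2) = (\<Sum>i<n. (cmod (p i))\<^sup>2)"
    by (intro sum.cong refl) (simp add: v_def if_distrib[of of_real] if_distrib[of "\<lambda>x. x * _"] cong: if_cong)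
  finally show ?thesis by simp
qed

lemma integral_fejer: "(LINT y|circle_lebesgue. fejer n (x - y)) = 2 * pi * n"
  using integral_identity_quadratic_form[where n = n and p = "\<lambda>j. cis (real j * x)"]
  by (simp add: fejer_def cis_mult algebra_simps)

section \<open>Density of Lipschitz functions on the circle\<close>

text \<open>Lipschitz for the chordal distance of the circle. This forces 2 pi-periodicity, and the
  distance is exactly the factor that \<open>cis_diff_mult_sum_le\<close> trades against a Dirichlet
  sum.\<close>

definition cis_lipschitz :: "(real \<Rightarrow> real) \<Rightarrow> bool" where
  "cis_lipschitz h \<longleftrightarrow> (\<exists>C\<ge>0. \<forall>x y. \<bar>h x - h y\<bar> \<le> C * cmod (cis x - cis y))"

lemma cis_lipschitz_continuous:
  assumes "cis_lipschitz h" shows "continuous_on UNIV h"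
proof -
  obtain C where C: "\<And>x y. \<bar>h x - h y\<bar> \<le> C * cmod (cis x - cis y)"
    using assms by (auto simp: cis_lipschitz_def)
  have "(h \<longlongrightarrow> h x) (at x)" for x
  proof -
    have "continuous_on UNIV (\<lambda>y. C * cmod (cis y - cis x))" by (intro continuous_intros)
    then have "((\<lambda>y. C * cmod (cis y - cis x)) \<longlongrightarrow> C * cmod (cis x - cis x)) (at x)"
      unfolding continuous_on_def by blast
    then have "((\<lambda>y. h y - h x) \<longlongrightarrow> 0) (at x)"
      using C by (intro Lim_null_comparison[of "\<lambda>y. h y - h x" "\<lambda>y. C * cmod (cis y - cis x)"]) auto
    then show ?thesis by (simp add: LIM_zero_iff)
  qed
  then show ?thesis by (simp add: continuous_on_def)
qed

lemma cis_lipschitz_add: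
  assumes "cis_lipschitz h" "cis_lipschitz k" shows "cis_lipschitz (\<lambda>x. h x + k x)"
proof -
  obtain C D where "C \<ge> 0" "\<And>x y. \<bar>h x - h y\<bar> \<le> C * cmod (cis x - cis y)"
    "D \<ge> 0" "\<And>x y. \<bar>k x - k y\<bar> \<le> D * cmod (cis x - cis y)"
    using assms unfolding cis_lipschitz_def by blast
  then have "\<bar>(h x + k x) - (h y + k y)\<bar> \<le> (C + D) * cmod (cis x - cis y)" for x y
    by (smt (verit) distrib_right)
  then show ?thesis unfolding cis_lipschitz_def using \<open>C \<ge> 0\<close> \<open>D \<ge> 0\<close>
    by (intro exI[of _ "C + D"]) auto
qed

definition L1_approximable :: "(real \<Rightarrow> real) \<Rightarrow> bool" where
  "L1_approximable g \<longleftrightarrow>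
     (\<forall>e>0. \<exists>h. cis_lipschitz h \<and> (LINT x|circle_lebesgue. \<bar>g x - h x\<bar>) < e)"

lemma integral_abs_diff_triangle:
  fixes f g h :: "'a \<Rightarrow> real"
  assumes "integrable M f" "integrable M g" "integrable M h"
  shows "(LINT x|M. \<bar>f x - h x\<bar>) \<le> (LINT x|M. \<bar>f x - g x\<bar>) + (LINT x|M. \<bar>g x - h x\<bar>)"
proof -
  have "(LINT x|M. \<bar>f x - h x\<bar>) \<le> (LINT x|M. \<bar>f x - g x\<bar> + \<bar>g x - h x\<bar>)"
    using assms by (intro integral_mono) auto
  then show ?thesis using assms by simp
qed

lemma L1_approximable_closed:
  assumes g: "integrable circle_lebesgue g"
    and ex: "\<And>e. e > 0 \<Longrightarrow> \<exists>k. integrable circle_lebesgue k \<and> L1_approximable k \<and>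
      (LINT x|circle_lebesgue. \<bar>g x - k x\<bar>) < e"
  shows "L1_approximable g"
  unfolding L1_approximable_def
proof (intro allI impI)
  fix e :: real assume "e > 0"
  then obtain k where k: "integrable circle_lebesgue k" "L1_approximable k"
    "(LINT x|circle_lebesgue. \<bar>g x - k x\<bar>) < e / 2"
    using ex[of "e / 2"] by auto
  obtain h where h: "cis_lipschitz h" "(LINT x|circle_lebesgue. \<bar>k x - h x\<bar>) < e / 2"
    using k(2) \<open>e > 0\<close> unfolding L1_approximable_def by (meson half_gt_zero)
  have "integrable circle_lebesgue h"
    by (intro continuous_integrable_circle cis_lipschitz_continuous h)
  from integral_abs_diff_triangle[OF g k(1) this]
  show "\<exists>h. cis_lipschitz h \<and> (LINT x|circle_lebesgue. \<bar>g x - h x\<bar>) < e"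
    using h k(3) by (intro exI[of _ h]) auto
qed

lemma L1_approximable_limit:
  assumes g: "integrable circle_lebesgue g"
    and s: "\<And>i. integrable circle_lebesgue (s i)" "\<And>i. L1_approximable (s i)"
    and lim: "AE x in circle_lebesgue. (\<lambda>i. s i x) \<longlonglongrightarrow> g x"
    and w: "integrable circle_lebesgue w" "\<And>i. AE x in circle_lebesgue. \<bar>s i x\<bar> \<le> w x"
  shows "L1_approximable g"
proof (rule L1_approximable_closed[OF g])
  fix e :: real assume "e > 0"
  have "(\<lambda>i. LINT x|circle_lebesgue. \<bar>g x - s i x\<bar>) \<longlonglongrightarrow> (LINT x|circle_lebesgue. 0)"
  proof (rule integral_dominated_convergence[where w = "\<lambda>x. \<bar>g x\<bar> + w x"])
    show "AE x in circle_lebesgue. (\<lambda>i. \<bar>g x - s i x\<bar>) \<longlonglongrightarrow> 0"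
      using lim by eventually_elim (auto intro!: tendsto_eq_intros)
    show "AE x in circle_lebesgue. norm \<bar>g x - s i x\<bar> \<le> \<bar>g x\<bar> + w x" for i
      using w(2)[of i] by eventually_elim auto
  qed (use g s w in auto)
  then have "eventually (\<lambda>i. (LINT x|circle_lebesgue. \<bar>g x - s i x\<bar>) < e) sequentially"
    using \<open>e > 0\<close> by (intro order_tendstoD(2)) auto
  then show "\<exists>k. integrable circle_lebesgue k \<and> L1_approximable k \<and>
      (LINT x|circle_lebesgue. \<bar>g x - k x\<bar>) < e"
    using s by (auto simp: eventually_sequentially)
qed

lemma AE_circle_interior: "AE x in circle_lebesgue. x \<in> {-pi<..<pi}"
proof -
  have "AE x in lebesgue. x \<noteq> c" for c :: real
    by (intro AE_completion AE_lborel_singleton)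
  then have "AE x in lebesgue. x \<noteq> pi \<and> x \<noteq> - pi" by (simp add: AE_conj_iff)
  then have "AE x in lebesgue. x \<in> {-pi..pi} \<longrightarrow> x \<in> {-pi<..<pi}"
    by eventually_elim auto
  then show ?thesis by (rule AE_restrict_space_iff[THEN iffD2, rotated]) simp
qed

text \<open>Only the two endpoints are identified by \<open>cis\<close>. Hence the distance on the
  circle to a closed subset of the interval detects membership at every interior point, that is,
  almost everywhere.\<close>

lemma cis_inj_interior:
  assumes "x \<in> {-pi<..<pi}" "y \<in> {-pi..pi}" "cis x = cis y" shows "x = y"
proof (cases "y = - pi")
  case True
  then have "cis x = cis pi" using assms(3) by (simp add: complex_eq_iff)
  moreover have "Arg (cis x) = x" "Arg (cis pi) = pi"
    using assms(1) by (auto intro!: Arg_cis simp del: cis_pi)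
  ultimately have "x = pi" by metis
  then show ?thesis using assms(1) by simp
next
  case False
  then have "Arg (cis x) = x" "Arg (cis y) = y" using assms(1,2) by (auto intro!: Arg_cis)
  then show ?thesis using assms(3) by metis
qed

lemma integrable_indicator_circle:
  "A \<in> sets circle_lebesgue \<Longrightarrow> integrable circle_lebesgue (\<lambda>x. indicator A x *\<^sub>R (c :: real))"
  using circle.emeasure_finite[of A]
  by (intro integrable_scaleR_left integrable_real_indicator) (simp_all add: less_top[symmetric])

lemma L1_approximable_indicator_closed:
  assumes K: "closed K" "K \<subseteq> {-pi..pi}"
  shows "L1_approximable (\<lambda>x. indicator K x *\<^sub>R c)"
proof (cases "K = {}")
  case True
  have "cis_lipschitz (\<lambda>_. 0)" unfolding cis_lipschitz_def by (rule exI[of _ 0]) simp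
  then show ?thesis using True unfolding L1_approximable_def by (intro allI impI exI[of _ "\<lambda>_. 0"]) simp
next
  case False
  have "compact K" using K compact_Int_closed[OF compact_Icc[of "-pi" pi] K(1)] by (simp add: Int_absorb1)
  then have cK: "closed (cis ` K)"
    by (intro compact_imp_closed compact_continuous_image continuous_intros)
  define d where "d x = infdist (cis x) (cis ` K)" for x
  \<comment> \<open>Tents around \<open>K\<close> that become steeper with \<open>i\<close>. At an
    endpoint outside \<open>K\<close> they may fail to tend to 0, namely if the other endpoint is in
    \<open>K\<close>; such points form a null set.\<close>
  define s where "s i x = c * max 0 (1 - real i * d x)" for i x
  have d0: "d x \<ge> 0" for x by (simp add: d_def infdist_nonneg)
  have s_lip: "cis_lipschitz (s i)" for i
    unfolding cis_lipschitz_def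
  proof (intro exI[of _ "\<bar>c\<bar> * real i"] conjI allI)
    fix x y
    have "\<bar>s i x - s i y\<bar> = \<bar>c\<bar> * \<bar>max 0 (1 - real i * d x) - max 0 (1 - real i * d y)\<bar>"
      by (simp add: s_def flip: abs_mult right_diff_distrib)
    also have "\<dots> \<le> \<bar>c\<bar> * \<bar>real i * d x - real i * d y\<bar>"
      by (intro mult_left_mono) auto
    also have "\<dots> = \<bar>c\<bar> * real i * \<bar>d x - d y\<bar>"
      by (simp add: abs_mult flip: right_diff_distrib)
    also have "\<dots> \<le> \<bar>c\<bar> * real i * cmod (cis x - cis y)"
      unfolding d_def using infdist_triangle_abs[of "cis x" "cis ` K" "cis y"]
      by (intro mult_left_mono) (auto simp: dist_norm)
    finally show "\<bar>s i x - s i y\<bar> \<le> \<bar>c\<bar> * real i * cmod (cis x - cis y)" .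
  qed simp
  show ?thesis
  proof (rule L1_approximable_limit[where s = s and w = "\<lambda>_. \<bar>c\<bar>"])
    have "K \<in> sets lebesgue" using K by auto
    then have "K \<in> sets circle_lebesgue" using K by (auto simp: sets_restrict_space_iff)
    then show "integrable circle_lebesgue (\<lambda>x. indicator K x *\<^sub>R c)"
      by (rule integrable_indicator_circle)
    show "integrable circle_lebesgue (s i)" for i
      by (intro continuous_integrable_circle cis_lipschitz_continuous s_lip)
    have "0 < e \<Longrightarrow> (LINT x|circle_lebesgue. \<bar>s i x - s i x\<bar>) < e" for i e by simp
    then show "L1_approximable (s i)" for i using s_lip unfolding L1_approximable_def by blast
    show "AE x in circle_lebesgue. (\<lambda>i. s i x) \<longlonglongrightarrow> indicator K x *\<^sub>R c"
      using AE_circle_interior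
    proof eventually_elim
      case (elim x)
      show ?case
      proof (cases "x \<in> K")
        case True
        then show ?thesis by (simp add: s_def d_def)
      next
        case x: False
        have "cis x \<notin> cis ` K" using cis_inj_interior[OF elim] K(2) x by blast
        then have "d x > 0" unfolding d_def using cK False
          by (intro infdist_pos_not_in_closed) auto
        then obtain N where N: "1 < real N * d x" using reals_Archimedean3 by blast
        have "s i x = 0" if "i \<ge> N" for i
        proof -
          have "real N * d x \<le> real i * d x" using that d0 by (intro mult_right_mono) auto
          then show ?thesis using N by (simp add: s_def max_def)
        qed
        then have "eventually (\<lambda>i. s i x = 0) sequentially"
          by (auto simp: eventually_sequentially)
        then show ?thesis using x by (simp add: tendsto_eventually)
      qed
    qed
    have "\<bar>s i x\<bar> \<le> \<bar>c\<bar>" for i x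
    proof -
      have "0 \<le> real i * d x" using d0 by simp
      then have "\<bar>max 0 (1 - real i * d x)\<bar> \<le> 1" by auto
      then show ?thesis unfolding s_def abs_mult by (intro mult_left_le) auto
    qed
    then show "AE x in circle_lebesgue. \<bar>s i x\<bar> \<le> \<bar>c\<bar>" for i by simp
  qed simp
qed

text \<open>Inner regularity of Lebesgue measure passes from closed to measurable sets; sums and
  dominated limits then reach every integrable function.\<close>

lemma integrable_L1_approximable:
  assumes "integrable circle_lebesgue (g :: real \<Rightarrow> real)"
  shows "L1_approximable g"
  using assms
proof (induction rule: integrable_induct)
  case (base A c)
  have A: "A \<in> sets lebesgue" "A \<subseteq> {-pi..pi}"
    using base(1) by (auto simp: sets_restrict_space_iff)
  show ?case
  proof (rule L1_approximable_closed[OF integrable_indicator_circle[OF base(1)]])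
    fix e :: real assume "e > 0"
    \<comment> \<open>Scaled so that e' |c| < e; the 1 in the denominator covers c = 0.\<close>
    define e' where "e' = e / (\<bar>c\<bar> + 1)"
    have "e' > 0" using \<open>e > 0\<close> by (simp add: e'_def)
    then obtain K where K: "closed K" "K \<subseteq> A" "A - K \<in> lmeasurable" "emeasure lebesgue (A - K) < ennreal e'"
      using sets_lebesgue_inner_closed[OF A(1)] by metis
    have KM: "K \<in> sets circle_lebesgue" using K A by (auto simp: sets_restrict_space_iff)
    have "(LINT x|circle_lebesgue. \<bar>indicator A x *\<^sub>R c - indicator K x *\<^sub>R c\<bar>) =
        (LINT x|circle_lebesgue. indicator (A - K) x * \<bar>c\<bar>)"
      using K(2) by (intro Bochner_Integration.integral_cong) (auto simp: indicator_def)
    also have "\<dots> = measure circle_lebesgue (A - K) * \<bar>c\<bar>"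
      using base(1) KM by (simp add: space_restrict_space Int_absorb2 A(2) Diff_subset_conv le_supI2)
    also have "measure circle_lebesgue (A - K) = measure lebesgue (A - K)"
      using A by (intro measure_restrict_space) auto
    also have "measure lebesgue (A - K) < e'"
      using K(3,4) \<open>e' > 0\<close> by (simp add: emeasure_eq_measure2 ennreal_less_iff)
    then have "measure lebesgue (A - K) * \<bar>c\<bar> \<le> e' * \<bar>c\<bar>" by (intro mult_right_mono) auto
    also have "\<dots> < e" using \<open>e > 0\<close> by (simp add: e'_def field_simps)
    finally show "\<exists>k. integrable circle_lebesgue k \<and> L1_approximable k \<and>
        (LINT x|circle_lebesgue. \<bar>indicator A x *\<^sub>R c - k x\<bar>) < e"
      using L1_approximable_indicator_closed[OF K(1), of c] K(2) A(2) integrable_indicator_circle[OF KM]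
      by (intro exI[of _ "\<lambda>x. indicator K x *\<^sub>R c"]) auto
  qed
next
  case (add f g)
  show ?case unfolding L1_approximable_def
  proof (intro allI impI)
    fix e :: real assume "e > 0"
    then have "e / 2 > 0" by simp
    then obtain h k where h: "cis_lipschitz h" "(LINT x|circle_lebesgue. \<bar>f x - h x\<bar>) < e / 2"
      and k: "cis_lipschitz k" "(LINT x|circle_lebesgue. \<bar>g x - k x\<bar>) < e / 2"
      using add.IH unfolding L1_approximable_def by meson
    have int: "integrable circle_lebesgue h" "integrable circle_lebesgue k"
      using h k by (auto intro: continuous_integrable_circle cis_lipschitz_continuous)
    have "(LINT x|circle_lebesgue. \<bar>(f x + g x) - (h x + k x)\<bar>) \<le>
        (LINT x|circle_lebesgue. \<bar>f x - h x\<bar> + \<bar>g x - k x\<bar>)"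
      using add.hyps int by (intro integral_mono) auto
    also have "\<dots> < e" using h k add.hyps int by simp
    finally show "\<exists>h. cis_lipschitz h \<and> (LINT x|circle_lebesgue. \<bar>f x + g x - h x\<bar>) < e"
      using cis_lipschitz_add[OF h(1) k(1)] by blast
  qed
next
  case (lim f s)
  show ?case
    by (rule L1_approximable_limit[where s = s and w = "\<lambda>x. 2 * \<bar>f x\<bar>"]) (use lim in auto)
qed

section \<open>Mean oscillation against the Fejer kernel\<close>

abbreviation torus_lebesgue :: "(real \<times> real) measure" where
  "torus_lebesgue \<equiv> circle_lebesgue \<Otimes>\<^sub>M circle_lebesgue"

lemma measurable_fejer [measurable]: "fejer n \<in> borel_measurable borel"
  by (intro borel_measurable_continuous_onI continuous_on_fejer continuous_on_id)

lemma measurable_ident_circle [measurable]: "(\<lambda>x. x) \<in> borel_measurable circle_lebesgue"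
  by (intro continuous_measurable_circle continuous_on_id)

lemma measurable_fst_torus [measurable]: "fst \<in> borel_measurable torus_lebesgue"
  and measurable_snd_torus [measurable]: "snd \<in> borel_measurable torus_lebesgue"
  using measurable_compose[OF measurable_fst measurable_ident_circle]
    measurable_compose[OF measurable_snd measurable_ident_circle] by auto

lemma integral_const_circle: "(LINT x|circle_lebesgue. c) = 2 * pi * (c :: real)"
  using measure_circle by (simp add: space_restrict_space)

lemma integrable_torus:
  fixes g :: "real \<Rightarrow> real"
  assumes g: "integrable circle_lebesgue g"
  shows "integrable torus_lebesgue (\<lambda>z. g (fst z))" "integrable torus_lebesgue (\<lambda>z. g (snd z))"
proof -
  note [measurable] = borel_measurable_integrable[OF g]
  show "integrable torus_lebesgue (\<lambda>z. g (fst z))"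
    by (rule circle_pair.Fubini_integrable) (use g in \<open>auto simp: integral_const_circle\<close>)
  show "integrable torus_lebesgue (\<lambda>z. g (snd z))"
    by (rule circle_pair.Fubini_integrable) (use g in auto)
qed

lemma integral_const_torus: "(LINT z|torus_lebesgue. c) = 4 * pi\<^sup>2 * (c :: real)"
proof -
  have "(LINT z|torus_lebesgue. c) = (LINT x|circle_lebesgue. LINT y|circle_lebesgue. c)"
    by (rule circle_pair.integral_fst'[OF integrable_torus(1)[of "\<lambda>_. c", OF circle.integrable_const], symmetric])
  also have "\<dots> = 2 * pi * (2 * pi * c)" by (simp only: integral_const_circle)
  finally show ?thesis by (simp add: power2_eq_square)
qed

lemma integrable_torus_mult_fejer:
  fixes h :: "real \<times> real \<Rightarrow> real"
  shows "integrable torus_lebesgue h \<Longrightarrow> integrable torus_lebesgue (\<lambda>z. h z * fejer n (fst z - snd z))"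
  by (rule integrable_mult_bounded[where B = "(real n)\<^sup>2"]) (auto simp: fejer_nonneg fejer_le)

lemma integral_torus_fejer_fst:
  fixes g :: "real \<Rightarrow> real"
  assumes g: "integrable circle_lebesgue g"
  shows "(LINT z|torus_lebesgue. g (fst z) * fejer n (fst z - snd z)) =
    2 * pi * n * (LINT x|circle_lebesgue. g x)"
  using circle_pair.integral_fst'[OF integrable_torus_mult_fejer[OF integrable_torus(1)[OF g]], of n]
  by (simp add: integral_fejer mult_ac)

lemma integral_torus_fejer_snd:
  fixes g :: "real \<Rightarrow> real"
  assumes g: "integrable circle_lebesgue g"
  shows "(LINT z|torus_lebesgue. g (snd z) * fejer n (fst z - snd z)) =
    2 * pi * n * (LINT x|circle_lebesgue. g x)"
proof -
  note [measurable] = borel_measurable_integrable[OF g]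
  have "(LINT z|torus_lebesgue. g (snd z) * fejer n (fst z - snd z)) =
      (LINT (x, y)|torus_lebesgue. g (snd (y, x)) * fejer n (fst (y, x) - snd (y, x)))"
    by (rule circle_pair.integral_product_swap[symmetric]) measurable
  also have "\<dots> = (LINT z|torus_lebesgue. g (fst z) * fejer n (fst z - snd z))"
    using fejer_minus[of n "_ - _"] by (simp add: split_def)
  finally show ?thesis using integral_torus_fejer_fst[OF g] by simp
qed

definition fejer_oscillation :: "nat \<Rightarrow> (real \<Rightarrow> real) \<Rightarrow> real" where
  "fejer_oscillation n g =
     (LINT z|torus_lebesgue. \<bar>g (snd z) - g (fst z)\<bar> * fejer n (fst z - snd z))"

lemma integrable_fejer_oscillation:
  assumes "integrable circle_lebesgue g"
  shows "integrable torus_lebesgue (\<lambda>z. \<bar>g (snd z) - g (fst z)\<bar> * fejer n (fst z - snd z))"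
  using integrable_torus[OF assms] by (intro integrable_torus_mult_fejer) auto

lemma fejer_oscillation_nonneg: "0 \<le> fejer_oscillation n g"
  unfolding fejer_oscillation_def by (intro integral_nonneg_AE) (auto simp: fejer_nonneg)

text \<open>Exchanging \<open>g\<close> for \<open>h\<close> costs |g - h| at each of the two
  arguments, and the kernel has mass 2 pi n in either variable.\<close>

lemma fejer_oscillation_approx:
  assumes g: "integrable circle_lebesgue g" and h: "integrable circle_lebesgue h"
  shows "fejer_oscillation n g \<le>
    fejer_oscillation n h + 4 * pi * n * (LINT x|circle_lebesgue. \<bar>g x - h x\<bar>)"
proof -
  define r where "r x = \<bar>g x - h x\<bar>" for x
  have r: "integrable circle_lebesgue r" unfolding r_def using g h by auto
  note int = integrable_fejer_oscillation[OF h] integrable_torus_mult_fejer[OF integrable_torus(1)[OF r]]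
    integrable_torus_mult_fejer[OF integrable_torus(2)[OF r]]
  have "fejer_oscillation n g \<le> (LINT z|torus_lebesgue.
      \<bar>h (snd z) - h (fst z)\<bar> * fejer n (fst z - snd z) +
      r (fst z) * fejer n (fst z - snd z) + r (snd z) * fejer n (fst z - snd z))"
    unfolding fejer_oscillation_def
  proof (intro integral_mono integrable_fejer_oscillation g h Bochner_Integration.integrable_add int)
    fix z
    have "\<bar>g (snd z) - g (fst z)\<bar> \<le> \<bar>h (snd z) - h (fst z)\<bar> + r (fst z) + r (snd z)"
      by (auto simp: r_def)
    then show "\<bar>g (snd z) - g (fst z)\<bar> * fejer n (fst z - snd z) \<le>
      \<bar>h (snd z) - h (fst z)\<bar> * fejer n (fst z - snd z) +
      r (fst z) * fejer n (fst z - snd z) + r (snd z) * fejer n (fst z - snd z)"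
      using fejer_nonneg by (simp add: mult_right_mono flip: distrib_right)
  qed
  also have "\<dots> = fejer_oscillation n h + 4 * pi * n * (LINT x|circle_lebesgue. r x)"
    using int by (simp add: fejer_oscillation_def integral_torus_fejer_fst[OF r] integral_torus_fejer_snd[OF r])
  finally show ?thesis by (simp add: r_def)
qed

text \<open>The Lipschitz bound contributes the distance d, and with d D <= 2 only one Dirichlet
  factor D of the kernel D^2 survives. Its integral is controlled through that of D^2.\<close>

lemma fejer_oscillation_cis_lipschitz:
  assumes "cis_lipschitz h"
  shows "\<exists>C. \<forall>n. fejer_oscillation n h \<le> C * sqrt n"
proof -
  obtain C where C: "C \<ge> 0" "\<And>x y. \<bar>h x - h y\<bar> \<le> C * cmod (cis x - cis y)"
    using assms by (auto simp: cis_lipschitz_def)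
  have h: "integrable circle_lebesgue h"
    by (intro continuous_integrable_circle cis_lipschitz_continuous assms)
  \<comment> \<open>Over the torus D^2 has integral 4 pi^2 n and the constant 4 sqrt n has integral
    16 pi^2 sqrt n; dividing the former by sqrt n and adding gives 20 pi^2 sqrt n.\<close>
  have "fejer_oscillation n h \<le> C / 2 * (20 * pi\<^sup>2) * sqrt n" for n
  proof (cases "n = 0")
    case True
    then show ?thesis by (simp add: fejer_oscillation_def fejer_def)
  next
    case False
    have one: "integrable circle_lebesgue (\<lambda>_. 1 :: real)" by simp
    note int = integrable_torus_mult_fejer[OF integrable_torus(1)[OF one], simplified]
    have "fejer_oscillation n h \<le>
        (LINT z|torus_lebesgue. C / 2 * (fejer n (fst z - snd z) / sqrt n + 4 * sqrt n))"
      unfolding fejer_oscillation_def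
    proof (intro integral_mono integrable_fejer_oscillation h)
      fix z :: "real \<times> real"
      obtain x y where z: "z = (x, y)" by fastforce
      define d where "d = cmod (cis x - cis y)"
      define D where "D = cmod (\<Sum>j<n. cis (real j * (x - y)))"
      have dD: "d * D \<le> 2" "0 \<le> d * D" using cis_diff_mult_sum_le[of x y n] by (simp_all add: d_def D_def)
      \<comment> \<open>This weight balances the two terms of the splitting: D^2 has integral of
        order n while (d D)^2 stays bounded, so n / s and s must be of equal size.\<close>
      define s where "s = sqrt n"
      have s: "s > 0" using False by (simp add: s_def)
      \<comment> \<open>AM-GM: \<open>2 d D\<^sup>2 \<le> D\<^sup>2 / s + s (d D)\<^sup>2\<close>\<close>
      have "(d * D)\<^sup>2 \<le> 2\<^sup>2" using dD by (intro power_mono)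
      then have "s * (d * D)\<^sup>2 \<le> s * 4" using s by simp
      moreover have "0 \<le> (s * d - 1)\<^sup>2 * D\<^sup>2 / s" using s by simp
      moreover have "(s * d - 1)\<^sup>2 * D\<^sup>2 / s = s * (d * D)\<^sup>2 + D\<^sup>2 / s - 2 * d * D\<^sup>2"
        using s by (simp add: field_simps power2_eq_square)
      ultimately have "2 * (d * D\<^sup>2) \<le> D\<^sup>2 / s + 4 * s" by simp
      then have "C / 2 * (2 * (d * D\<^sup>2)) \<le> C / 2 * (D\<^sup>2 / s + 4 * s)"
        using C(1) by (intro mult_left_mono) auto
      moreover have "\<bar>h y - h x\<bar> * D\<^sup>2 \<le> C * d * D\<^sup>2"
        using C(2)[of y x] by (intro mult_right_mono) (auto simp: d_def norm_minus_commute)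
      ultimately show "\<bar>h (snd z) - h (fst z)\<bar> * fejer n (fst z - snd z) \<le>
          C / 2 * (fejer n (fst z - snd z) / sqrt n + 4 * sqrt n)"
        by (simp add: z fejer_def D_def s_def)
    next
      show "integrable torus_lebesgue
         (\<lambda>z. C / 2 * (fejer n (fst z - snd z) / sqrt n + 4 * sqrt n))"
        using int integrable_torus(1)[of "\<lambda>_. 4 * sqrt n"] by auto
    qed
    also have "\<dots> = C / 2 * ((LINT z|torus_lebesgue. fejer n (fst z - snd z)) / sqrt n +
        (LINT z|torus_lebesgue. 4 * sqrt n))"
      using int integrable_torus(1)[of "\<lambda>_. 4 * sqrt n"] by simp
    also have "(LINT z|torus_lebesgue. fejer n (fst z - snd z)) = 4 * pi\<^sup>2 * n"
      using integral_torus_fejer_fst[OF one, of n] integral_const_circle[of 1]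
      by (simp add: power2_eq_square)
    also have "(LINT z|torus_lebesgue. 4 * sqrt n) = 16 * pi\<^sup>2 * sqrt n"
      by (simp only: integral_const_torus)
    also have "C / 2 * (4 * pi\<^sup>2 * n / sqrt n + 16 * pi\<^sup>2 * sqrt n) = C / 2 * (20 * pi\<^sup>2) * sqrt n"
    proof -
      define s where "s = sqrt n"
      have n: "real n = s * s" and "s > 0" using False by (simp_all add: s_def)
      show ?thesis unfolding s_def[symmetric] unfolding n using \<open>s > 0\<close> by (simp add: field_simps)
    qed
    finally show ?thesis .
  qed
  then show ?thesis by blast
qed

lemma fejer_oscillation_tendsto:
  assumes g: "integrable circle_lebesgue g"
  shows "(\<lambda>n. fejer_oscillation n g / n) \<longlonglongrightarrow> 0"
proof (rule LIMSEQ_I)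
  fix e :: real assume e: "e > 0"
  \<comment> \<open>Chosen so that the approximation error 4 pi n e' equals n e / 2.\<close>
  define e' where "e' = e / (8 * pi)"
  have "e' > 0" using e by (simp add: e'_def)
  then obtain h where h: "cis_lipschitz h" "(LINT x|circle_lebesgue. \<bar>g x - h x\<bar>) < e'"
    using integrable_L1_approximable[OF g] unfolding L1_approximable_def by blast
  have hi: "integrable circle_lebesgue h"
    by (intro continuous_integrable_circle cis_lipschitz_continuous h)
  obtain C where C: "\<And>n. fejer_oscillation n h \<le> C * sqrt n"
    using fejer_oscillation_cis_lipschitz[OF h(1)] by blast
  have "(\<lambda>n. C / sqrt (real n)) \<longlonglongrightarrow> 0"
    by (intro real_tendsto_divide_at_top[OF tendsto_const] filterlim_compose[OF sqrt_at_top]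
        filterlim_real_sequentially)
  then have "eventually (\<lambda>n. C / sqrt (real n) < e / 2) sequentially"
    using e by (intro order_tendstoD(2)) auto
  then obtain N where N: "\<And>n. n \<ge> N \<Longrightarrow> C / sqrt (real n) < e / 2"
    by (auto simp: eventually_sequentially)
  show "\<exists>no. \<forall>n\<ge>no. norm (fejer_oscillation n g / n - 0) < e"
  proof (intro exI[of _ "max N 1"] allI impI)
    fix n assume "max N 1 \<le> n"
    then have n: "n \<ge> N" "n > 0" by auto
    have "fejer_oscillation n g \<le> C * sqrt n + 4 * pi * n * (LINT x|circle_lebesgue. \<bar>g x - h x\<bar>)"
      using fejer_oscillation_approx[OF g hi, of n] C[of n] by linarith
    also have "\<dots> \<le> C * sqrt n + 4 * pi * n * e'"
      using h(2) by (intro add_left_mono mult_left_mono) auto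
    also have "4 * pi * n * e' = n * (e / 2)" by (simp add: e'_def)
    finally have "fejer_oscillation n g / n \<le> (C * sqrt n + n * (e / 2)) / n"
      using n by (intro divide_right_mono) auto
    also have "\<dots> = C / sqrt n + e / 2"
    proof -
      have "real n = sqrt n * sqrt n" by simp
      then have "C * sqrt n / n = C / sqrt n"
        using n by (metis mult_divide_mult_cancel_right of_nat_0_less_iff real_sqrt_gt_0_iff less_irrefl)
      then show ?thesis using n by (simp add: add_divide_distrib)
    qed
    also have "\<dots> < e" using N[OF n(1)] by linarith
    finally show "norm (fejer_oscillation n g / n - 0) < e"
      using fejer_oscillation_nonneg[of n g] by simp
  qed
qed

section \<open>Deviation of the eigenvalues of one parity\<close>

lemma sum_flip: "(\<Sum>j<n. F (n - 1 - j)) = (\<Sum>j<n. F j)" for F :: "nat \<Rightarrow> 'a::comm_monoid_add"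
  using sum.nat_diff_reindex[of F n] by simp

text \<open>\<open>s\<close> selects one parity, so that a single argument serves both. The
  eigenvectors of both parities are kept because completeness and the spectral decomposition involve
  all of them.\<close>

locale toeplitz_parity_eigenbasis =
  fixes n :: nat and g :: "real \<Rightarrow> real" and v :: "nat \<Rightarrow> nat \<Rightarrow> real" and l :: "nat \<Rightarrow> real"
    and s :: real
  assumes g: "integrable circle_lebesgue g"
    and even: "AE x in circle_lebesgue. g (- x) = g x"
    and complete: "\<And>j k. j < n \<Longrightarrow> k < n \<Longrightarrow> (\<Sum>i<n. v i j * v i k) = (if j = k then 1 else 0)"
    and orthonormal: "\<And>i k. i < n \<Longrightarrow> k < n \<Longrightarrow> (\<Sum>j<n. v i j * v k j) = (if i = k then 1 else 0)"
    and parity: "\<And>i j. i < n \<Longrightarrow> j < n \<Longrightarrow> v i (n - 1 - j) = (-1) ^ i * v i j"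
    and spectral: "\<And>j k. j < n \<Longrightarrow> k < n \<Longrightarrow>
      (LINT y|circle_lebesgue. of_real (g y) * cis (of_int (int k - int j) * y)) =
        of_real (2 * pi * (\<Sum>i<n. l i * v i j * v i k))"
    and s: "s = 1 \<or> s = -1"
begin

text \<open>With \<open>e(x) = (cis (j x))\<^sub>j\<close>, the vector \<open>P x\<close> is the projection of \<open>e(x)\<close> onto the vectors of parity
  \<open>s\<close>, \<open>R x y = \<bar>\<langle>P x, e(y)\<rangle>\<bar>\<^sup>2\<close>, \<open>K x = \<bar>P x\<bar>\<^sup>2\<close> and \<open>q x = \<langle>T P x, P x\<rangle>\<close> for the Toeplitz matrix \<open>T\<close>.\<close>

definition I :: "nat set" where "I = {i. i < n \<and> (-1) ^ i = s}"
definition W :: "nat \<Rightarrow> real \<Rightarrow> real" where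
  "W i x = (cmod (\<Sum>j<n. of_real (v i j) * cis (real j * x)))\<^sup>2"
definition P :: "real \<Rightarrow> nat \<Rightarrow> complex" where
  "P x j = (cis (real j * x) + of_real s * cis (real (n - 1 - j) * x)) / 2"
definition R :: "real \<Rightarrow> real \<Rightarrow> real" where
  "R x y = (cmod (\<Sum>j<n. P x j * cis (- (real j * y))))\<^sup>2"
definition K :: "real \<Rightarrow> real" where "K x = (\<Sum>i\<in>I. W i x)"
definition q :: "real \<Rightarrow> real" where "q x = (\<Sum>i\<in>I. l i * W i x)"

lemma I: "finite I" "I \<subseteq> {..<n}" by (auto simp: I_def)

lemma W_nonneg: "0 \<le> W i x" by (simp add: W_def)
lemma K_nonneg: "0 \<le> K x" by (simp add: K_def W_nonneg sum_nonneg)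
lemma R_nonneg: "0 \<le> R x y" by (simp add: R_def)

lemma continuous_W: "continuous_on UNIV (W i)"
  unfolding W_def by (intro continuous_intros)
lemma continuous_q: "continuous_on UNIV q"
  unfolding q_def by (intro continuous_intros continuous_W)
lemma continuous_R: "continuous_on UNIV (R x)"
  unfolding R_def by (intro continuous_intros)

text \<open>Reversal acts on \<open>v i\<close> as (-1)^i, so pairing with \<open>P x\<close>
  multiplies the pairing with e(x) by (1 + s (-1)^i) / 2, which is 1 for equal signs and 0 for
  opposite ones.\<close>

lemma project:
  assumes "i < n"
  shows "(\<Sum>j<n. of_real (v i j) * P x j) =
    (if i \<in> I then \<Sum>j<n. of_real (v i j) * cis (real j * x) else 0)"
proof -
  let ?E = "\<Sum>j<n. of_real (v i j) * cis (real j * x)"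
  have "(\<Sum>j<n. of_real (v i j) * cis (real (n - 1 - j) * x)) =
      (\<Sum>j<n. of_real (v i (n - 1 - j)) * cis (real j * x))"
    using sum_flip[of "\<lambda>j. of_real (v i (n - 1 - j)) * cis (real j * x)" n] by simp
  also have "\<dots> = (\<Sum>j<n. (-1) ^ i * (of_real (v i j) * cis (real j * x)))"
    using parity[OF assms] by (intro sum.cong refl) (simp del: One_nat_def)
  finally have flip: "(\<Sum>j<n. of_real (v i j) * cis (real (n - 1 - j) * x)) = (-1) ^ i * ?E"
    by (simp add: sum_distrib_left)
  have "(\<Sum>j<n. of_real (v i j) * P x j) =
      (?E + of_real s * (\<Sum>j<n. of_real (v i j) * cis (real (n - 1 - j) * x))) / 2"
  proof -
    have "(\<Sum>j<n. of_real (v i j) * P x j) = (\<Sum>j<n. (of_real (v i j) * cis (real j * x) +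
        of_real s * (of_real (v i j) * cis (real (n - 1 - j) * x))) / 2)"
      by (intro sum.cong refl) (simp add: P_def distrib_left mult_ac)
    also have "\<dots> = (?E + of_real s * (\<Sum>j<n. of_real (v i j) * cis (real (n - 1 - j) * x))) / 2"
      by (simp only: sum.distrib sum_distrib_left flip: sum_divide_distrib)
    finally show ?thesis .
  qed
  also have "\<dots> = (1 + of_real s * (-1) ^ i) / 2 * ?E"
    unfolding flip by (simp add: field_simps)
  also have "(1 + of_real s * (-1) ^ i) / 2 = (if i \<in> I then 1 else (0 :: complex))"
    using s assms by (cases "Parity.even i") (auto simp: I_def)
  finally show ?thesis by simp
qed

lemma sum_project:
  "(\<Sum>i<n. \<theta> i * (cmod (\<Sum>j<n. of_real (v i j) * P x j))\<^sup>2) = (\<Sum>i\<in>I. \<theta> i * W i x)"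
  using I by (intro sum.mono_neutral_cong_right) (auto simp: project W_def)

lemma integral_g_R: "(LINT y|circle_lebesgue. g y * R x y) = 2 * pi * q x"
  unfolding R_def q_def using integral_quadratic_form[OF g spectral, of n "P x"]
  by (simp only: sum_project)

lemma coeff_one:
  assumes "j < n" "k < n"
  shows "(LINT y|circle_lebesgue. of_real 1 * cis (of_int (int k - int j) * y)) =
    of_real (2 * pi * (\<Sum>i<n. 1 * v i j * v i k))"
  using complete[OF assms] unfolding of_real_1 mult_1 integral_cis_int by auto

lemma integral_R: "(LINT y|circle_lebesgue. R x y) = 2 * pi * K x"
proof -
  have "(LINT y|circle_lebesgue. 1 * R x y) = 2 * pi * (\<Sum>i\<in>I. 1 * W i x)"
    unfolding R_def using integral_quadratic_form[OF _ coeff_one, of n "P x"]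
    by (simp only: sum_project) simp
  then show ?thesis by (simp add: K_def)
qed

text \<open>In |P x j|^2 the interference of a coordinate with its mirror image is a cosine of
  frequency 2j - (n - 1). These frequencies have spacing 2, hence the Dirichlet sum at 2x.\<close>

lemma K_approx: "\<bar>K x - n / 2\<bar> \<le> cmod (\<Sum>j<n. cis (real j * (2 * x))) / 2"
proof -
  have norm_P: "(cmod (P x j))\<^sup>2 = 1 / 2 + s / 2 * cos ((2 * real j - real (n - 1)) * x)" if "j < n" for j
  proof -
    define a b where "a = real j * x" and "b = real (n - 1 - j) * x"
    have ab: "(2 * real j - real (n - 1)) * x = a - b"
      using that by (simp add: a_def b_def of_nat_diff algebra_simps)
    have "(cmod (cis a + of_real s * cis b))\<^sup>2 = (cos a + s * cos b)\<^sup>2 + (sin a + s * sin b)\<^sup>2"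
      by (simp add: cmod_power2)
    also have "\<dots> = ((cos a)\<^sup>2 + (sin a)\<^sup>2) + s\<^sup>2 * ((cos b)\<^sup>2 + (sin b)\<^sup>2) + 2 * s * cos (a - b)"
    proof -
      have "(p + s * r)\<^sup>2 + (p' + s * r')\<^sup>2 =
          (p\<^sup>2 + p'\<^sup>2) + s\<^sup>2 * (r\<^sup>2 + r'\<^sup>2) + 2 * s * (p * r + p' * r')" for p p' r r' :: real
        by (simp add: power2_eq_square algebra_simps)
      then show ?thesis by (simp only: cos_diff)
    qed
    also have "\<dots> = 2 + 2 * s * cos (a - b)" using s by auto
    finally have "(cmod (cis a + of_real s * cis b))\<^sup>2 = 2 + 2 * s * cos (a - b)" .
    then show ?thesis unfolding P_def ab a_def[symmetric] b_def[symmetric]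
      by (simp add: norm_divide power_divide)
  qed
  \<comment> \<open>The integral of \<open>R x\<close> is evaluated in two ways: in the eigenbasis
    and by Parseval in the standard basis.\<close>
  have "2 * pi * K x = 2 * pi * (\<Sum>j<n. (cmod (P x j))\<^sup>2)"
    using integral_R[of x] integral_identity_quadratic_form[where n = n and p = "P x"] by (simp add: R_def)
  then have "K x = (\<Sum>j<n. (cmod (P x j))\<^sup>2)" by simp
  also have "\<dots> = n / 2 + s / 2 * (\<Sum>j<n. cos ((2 * real j - real (n - 1)) * x))"
    by (simp add: norm_P sum.distrib sum_distrib_left)
  finally have "\<bar>K x - n / 2\<bar> = \<bar>\<Sum>j<n. cos ((2 * real j - real (n - 1)) * x)\<bar> / 2"
    using s by (auto simp: abs_mult)
  \<comment> \<open>The common shift n - 1 of the frequencies is a unimodular factor and disappears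
    from the modulus.\<close>
  also have "(\<Sum>j<n. cos ((2 * real j - real (n - 1)) * x)) =
      Re (cis (- (real (n - 1) * x)) * (\<Sum>j<n. cis (real j * (2 * x))))"
    unfolding sum_distrib_left cis_mult by (simp add: algebra_simps)
  also have "\<bar>\<dots>\<bar> \<le> cmod (\<Sum>j<n. cis (real j * (2 * x)))"
    using abs_Re_le_cmod[of "cis (- (real (n - 1) * x)) * (\<Sum>j<n. cis (real j * (2 * x)))"]
    by (simp add: norm_mult)
  finally show ?thesis by simp
qed

text \<open>The two halves of \<open>P x\<close> pair with e(y) to sums whose squared moduli are the
  Fejer kernels at x - y and x + y. The cross term is removed by (a + b)^2 <= 2 (a^2 + b^2).\<close>

lemma R_le: "R x y \<le> (fejer n (x - y) + fejer n (x + y)) / 2"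
proof -
  define a where "a = (\<Sum>j<n. cis (real j * (x - y)))"
  define b where "b = (\<Sum>j<n. cis (real (n - 1 - j) * x) * cis (- (real j * y)))"
  have "b = (\<Sum>j<n. cis (real (n - 1) * x) * cis (real j * (- (x + y))))"
    unfolding b_def by (intro sum.cong refl) (simp add: cis_mult of_nat_diff algebra_simps)
  then have "cmod b = cmod (\<Sum>j<n. cis (real j * (- (x + y))))"
    by (simp add: norm_mult flip: sum_distrib_left)
  then have b: "(cmod b)\<^sup>2 = fejer n (x + y)" using fejer_minus[of n "x + y"] by (simp add: fejer_def)
  have a: "(cmod a)\<^sup>2 = fejer n (x - y)" by (simp add: fejer_def a_def)
  have "(\<Sum>j<n. P x j * cis (- (real j * y))) = (a + of_real s * b) / 2"
  proof -
    have "(\<Sum>j<n. P x j * cis (- (real j * y))) = (\<Sum>j<n. (cis (real j * (x - y)) +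
        of_real s * (cis (real (n - 1 - j) * x) * cis (- (real j * y)))) / 2)"
      by (intro sum.cong refl) (simp add: P_def distrib_right add_divide_distrib cis_mult algebra_simps)
    also have "\<dots> = (a + of_real s * b) / 2"
      unfolding a_def b_def by (simp only: sum.distrib sum_distrib_left flip: sum_divide_distrib)
    finally show ?thesis .
  qed
  then have "R x y = (cmod ((a + of_real s * b) / 2))\<^sup>2" by (simp only: R_def)
  also have "\<dots> = (cmod (a + of_real s * b))\<^sup>2 / 4" by (simp add: norm_divide power_divide)
  also have "cmod (a + of_real s * b) \<le> cmod a + cmod b"
    using norm_triangle_ineq[of a "of_real s * b"] s by (auto simp: norm_mult)
  then have "(cmod (a + of_real s * b))\<^sup>2 \<le> (cmod a + cmod b)\<^sup>2" by (intro power_mono) auto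
  also have "(cmod a + cmod b)\<^sup>2 \<le> 2 * ((cmod a)\<^sup>2 + (cmod b)\<^sup>2)"
    using sum_squares_bound[of "cmod a" "cmod b"] by (simp add: power2_sum)
  finally show ?thesis by (simp add: a b)
qed

lemma W_conj: "W i y = (cmod (\<Sum>j<n. of_real (v i j) * cis (- (real j * y))))\<^sup>2"
proof -
  have "(\<Sum>j<n. of_real (v i j) * cis (- (real j * y))) = cnj (\<Sum>j<n. of_real (v i j) * cis (real j * y))"
    by (simp add: cis_cnj)
  then show ?thesis unfolding W_def by (simp only: complex_mod_cnj)
qed

lemma integral_W: "i < n \<Longrightarrow> (LINT y|circle_lebesgue. W i y) = 2 * pi"
  using integral_identity_quadratic_form[where n = n and p = "\<lambda>j. of_real (v i j)"] orthonormal[of i i]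
  by (simp add: W_conj power2_eq_square)

text \<open>The quadratic form is evaluated at the eigenvector itself. Together with
  \<open>integral_W\<close> this makes \<open>l i\<close> the mean of \<open>g\<close> under the
  probability density W i / (2 pi).\<close>

lemma integral_g_W:
  assumes "i < n" shows "(LINT y|circle_lebesgue. g y * W i y) = 2 * pi * l i"
proof -
  have "(LINT y|circle_lebesgue. g y * W i y) =
      2 * pi * (\<Sum>k<n. l k * (cmod (\<Sum>j<n. of_real (v k j) * of_real (v i j)))\<^sup>2)"
    unfolding W_conj by (rule integral_quadratic_form[OF g spectral])
  also have "(\<Sum>k<n. l k * (cmod (\<Sum>j<n. of_real (v k j) * of_real (v i j)))\<^sup>2) = (\<Sum>k<n. if k = i then l k else 0)"
    using assms orthonormal by (intro sum.cong refl) (simp flip: of_real_mult of_real_sum)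
  finally show ?thesis using assms by simp
qed

lemma integrable_mult_cont:
  assumes "integrable circle_lebesgue h" "continuous_on UNIV k" "\<And>x. \<bar>k x\<bar> \<le> B"
  shows "integrable circle_lebesgue (\<lambda>x. h x * k x :: real)"
  using assms by (intro integrable_mult_bounded[where B = B] continuous_measurable_circle) auto

lemma W_le: "\<bar>W i x\<bar> \<le> (\<Sum>j<n. \<bar>v i j\<bar>)\<^sup>2"
proof -
  have "cmod (\<Sum>j<n. of_real (v i j) * cis (real j * x)) \<le> (\<Sum>j<n. \<bar>v i j\<bar>)"
    by (rule order_trans[OF norm_sum]) (simp add: norm_mult)
  then show ?thesis by (auto simp: W_def intro!: power_mono)
qed

lemma integrable_mult_W: "integrable circle_lebesgue h \<Longrightarrow> integrable circle_lebesgue (\<lambda>x. h x * W i x)"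
  by (rule integrable_mult_cont[OF _ continuous_W W_le])

lemma integrable_mult_K: "integrable circle_lebesgue h \<Longrightarrow> integrable circle_lebesgue (\<lambda>x. h x * K x)"
  unfolding K_def sum_distrib_left by (intro Bochner_Integration.integrable_sum integrable_mult_W)

lemma R_bound: "\<bar>R x y\<bar> \<le> (real n)\<^sup>2"
  using R_le[of x y] fejer_le[of n "x - y"] fejer_le[of n "x + y"] R_nonneg[of x y] by simp

lemma integrable_mult_R: "integrable circle_lebesgue h \<Longrightarrow> integrable circle_lebesgue (\<lambda>y. h y * R x y)"
  by (rule integrable_mult_cont[OF _ continuous_R R_bound])

lemma integrable_mult_fejer:
  "integrable circle_lebesgue h \<Longrightarrow> integrable circle_lebesgue (\<lambda>y. h y * fejer n (x - y))"
  "integrable circle_lebesgue h \<Longrightarrow> integrable circle_lebesgue (\<lambda>y. h y * fejer n (x + y))"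
  by (rule integrable_mult_cont[where B = "(real n)\<^sup>2"];
      auto intro!: continuous_intros simp: fejer_nonneg fejer_le)+

text \<open>As \<open>R x\<close> has mass 2 pi K x, the left-hand side is the modulus of the
  integral of \<open>g y - g x\<close> against \<open>R x\<close>, to which \<open>R_le\<close>
  applies.\<close>

lemma defect_pointwise:
  "2 * pi * \<bar>q x - g x * K x\<bar> \<le> (LINT y|circle_lebesgue. \<bar>g y - g x\<bar> * fejer n (x - y))"
proof -
  have int: "integrable circle_lebesgue (\<lambda>y. g y - g x)" "integrable circle_lebesgue (\<lambda>y. \<bar>g y - g x\<bar>)"
    using g by auto
  have R: "integrable circle_lebesgue (R x)"
    by (intro continuous_integrable_circle continuous_R)
  have "2 * pi * (q x - g x * K x) = (LINT y|circle_lebesgue. g y * R x y) - g x * (LINT y|circle_lebesgue. R x y)"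
    by (simp add: integral_g_R integral_R algebra_simps)
  also have "\<dots> = (LINT y|circle_lebesgue. (g y - g x) * R x y)"
    using integrable_mult_R[OF g, of x] R by (simp add: left_diff_distrib)
  finally have "2 * pi * \<bar>q x - g x * K x\<bar> = \<bar>LINT y|circle_lebesgue. (g y - g x) * R x y\<bar>"
    by (metis abs_mult abs_of_pos pi_gt_zero zero_less_mult_iff zero_less_numeral)
  also have "\<dots> \<le> (LINT y|circle_lebesgue. \<bar>(g y - g x) * R x y\<bar>)" by (rule integral_abs_bound)
  also have "\<dots> \<le> (LINT y|circle_lebesgue. \<bar>g y - g x\<bar> * fejer n (x - y) / 2 + \<bar>g y - g x\<bar> * fejer n (x + y) / 2)"
  proof (rule integral_mono)
    fix y
    have "\<bar>(g y - g x) * R x y\<bar> = \<bar>g y - g x\<bar> * R x y" using R_nonneg by (simp add: abs_mult)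
    also have "\<dots> \<le> \<bar>g y - g x\<bar> * ((fejer n (x - y) + fejer n (x + y)) / 2)"
      by (intro mult_left_mono R_le) auto
    finally show "\<bar>(g y - g x) * R x y\<bar> \<le> \<bar>g y - g x\<bar> * fejer n (x - y) / 2 + \<bar>g y - g x\<bar> * fejer n (x + y) / 2"
      by (simp add: algebra_simps add_divide_distrib)
  qed (use integrable_mult_R[OF int(1), of x] integrable_mult_fejer[OF int(2), of x] in auto)
  also have "\<dots> = (LINT y|circle_lebesgue. \<bar>g y - g x\<bar> * fejer n (x - y)) / 2 +
      (LINT y|circle_lebesgue. \<bar>g y - g x\<bar> * fejer n (x + y)) / 2"
    using integrable_mult_fejer[OF int(2), of x] by simp
  \<comment> \<open>The reflection of y preserves the interval and moves the peak from y = -x to y =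
    x; evenness then restores \<open>g y\<close>.\<close>
  also have "(LINT y|circle_lebesgue. \<bar>g y - g x\<bar> * fejer n (x + y)) =
      (LINT y|circle_lebesgue. \<bar>g (- y) - g x\<bar> * fejer n (x - y))"
    using integral_reflect_real[of pi "-pi" "\<lambda>y. \<bar>g y - g x\<bar> * fejer n (x + y)"] by simp
  also have "\<dots> = (LINT y|circle_lebesgue. \<bar>g y - g x\<bar> * fejer n (x - y))"
  proof (rule integral_cong_AE)
    note [measurable] = borel_measurable_integrable[OF g]
    have [measurable]: "(\<lambda>y. g (- y)) \<in> borel_measurable circle_lebesgue"
      using integrable_reflect_real[of pi "-pi" g] g by (intro borel_measurable_integrable) simp
    show "(\<lambda>y. \<bar>g (- y) - g x\<bar> * fejer n (x - y)) \<in> borel_measurable circle_lebesgue" by measurable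
    show "(\<lambda>y. \<bar>g y - g x\<bar> * fejer n (x - y)) \<in> borel_measurable circle_lebesgue" by measurable
    show "AE y in circle_lebesgue. \<bar>g (- y) - g x\<bar> * fejer n (x - y) = \<bar>g y - g x\<bar> * fejer n (x - y)"
      using even by eventually_elim simp
  qed
  finally show ?thesis by simp
qed

lemma defect: "2 * pi * (LINT x|circle_lebesgue. \<bar>q x - g x * K x\<bar>) \<le> fejer_oscillation n g"
proof -
  have "integrable circle_lebesgue q" by (intro continuous_integrable_circle continuous_q)
  then have "(LINT x|circle_lebesgue. 2 * pi * \<bar>q x - g x * K x\<bar>) \<le>
      (LINT x|circle_lebesgue. LINT y|circle_lebesgue. \<bar>g y - g x\<bar> * fejer n (x - y))"
    using circle_pair.integrable_fst'[OF integrable_fejer_oscillation[OF g], of n] integrable_mult_K[OF g]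
    by (intro integral_mono defect_pointwise) auto
  also have "\<dots> = fejer_oscillation n g"
    unfolding fejer_oscillation_def
    using circle_pair.integral_fst'[OF integrable_fejer_oscillation[OF g], of n] by simp
  finally show ?thesis by simp
qed

lemma upper: "2 * pi * (\<Sum>i\<in>I. \<bar>l i - c\<bar>) \<le> (LINT x|circle_lebesgue. \<bar>g x - c\<bar> * K x)"
proof -
  have gc: "integrable circle_lebesgue (\<lambda>x. g x - c)" using g by auto
  have "2 * pi * \<bar>l i - c\<bar> \<le> (LINT x|circle_lebesgue. \<bar>g x - c\<bar> * W i x)" if "i \<in> I" for i
  proof -
    have i: "i < n" using that I by auto
    have "integrable circle_lebesgue (W i)" by (intro continuous_integrable_circle continuous_W)
    then have "(LINT x|circle_lebesgue. (g x - c) * W i x) = 2 * pi * (l i - c)"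
      using integrable_mult_W[OF g, of i]
      by (simp add: left_diff_distrib integral_g_W[OF i] integral_W[OF i] algebra_simps)
    then have "2 * pi * \<bar>l i - c\<bar> = \<bar>LINT x|circle_lebesgue. (g x - c) * W i x\<bar>"
      by (simp add: abs_mult)
    also have "\<dots> \<le> (LINT x|circle_lebesgue. \<bar>(g x - c) * W i x\<bar>)" by (rule integral_abs_bound)
    finally show ?thesis by (simp add: abs_mult W_nonneg)
  qed
  then have "(\<Sum>i\<in>I. 2 * pi * \<bar>l i - c\<bar>) \<le> (\<Sum>i\<in>I. LINT x|circle_lebesgue. \<bar>g x - c\<bar> * W i x)"
    by (rule sum_mono)
  also have "\<dots> = (LINT x|circle_lebesgue. \<bar>g x - c\<bar> * K x)"
    unfolding K_def sum_distrib_left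
    using gc by (intro Bochner_Integration.integral_sum[symmetric] integrable_mult_W) auto
  finally show ?thesis by (simp add: sum_distrib_left)
qed

lemma lower: "(LINT x|circle_lebesgue. \<bar>g x - c\<bar> * K x) - fejer_oscillation n g / (2 * pi) \<le>
    2 * pi * (\<Sum>i\<in>I. \<bar>l i - c\<bar>)"
proof -
  have gc: "integrable circle_lebesgue (\<lambda>x. \<bar>g x - c\<bar>)" using g by auto
  have W: "integrable circle_lebesgue (W i)" for i by (intro continuous_integrable_circle continuous_W)
  have qgK: "integrable circle_lebesgue (\<lambda>x. \<bar>q x - g x * K x\<bar>)"
    using integrable_mult_K[OF g] continuous_integrable_circle[OF continuous_q] by auto
  have "(LINT x|circle_lebesgue. \<bar>g x - c\<bar> * K x) - (LINT x|circle_lebesgue. \<bar>q x - g x * K x\<bar>) =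
      (LINT x|circle_lebesgue. \<bar>g x - c\<bar> * K x - \<bar>q x - g x * K x\<bar>)"
    using integrable_mult_K[OF gc] qgK by simp
  also have "\<dots> \<le> (LINT x|circle_lebesgue. (\<Sum>i\<in>I. \<bar>l i - c\<bar> * W i x))"
  proof (rule integral_mono)
    fix x
    have "\<bar>q x - c * K x\<bar> = \<bar>\<Sum>i\<in>I. (l i - c) * W i x\<bar>"
      by (simp add: q_def K_def left_diff_distrib sum_subtractf sum_distrib_left)
    also have "\<dots> \<le> (\<Sum>i\<in>I. \<bar>(l i - c) * W i x\<bar>)" by (rule sum_abs)
    finally have "\<bar>q x - c * K x\<bar> \<le> (\<Sum>i\<in>I. \<bar>l i - c\<bar> * W i x)" by (simp add: abs_mult W_nonneg)
    \<comment> \<open>As \<open>K x\<close> is nonnegative, |g - c| K is the modulus of gK - cK, and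
      the triangle inequality through \<open>q x\<close> bounds it by |q - gK| + |q - cK|.\<close>
    moreover have "\<bar>g x - c\<bar> * K x = \<bar>g x * K x - c * K x\<bar>"
      using K_nonneg[of x] by (simp add: abs_mult flip: left_diff_distrib)
    ultimately show "\<bar>g x - c\<bar> * K x - \<bar>q x - g x * K x\<bar> \<le> (\<Sum>i\<in>I. \<bar>l i - c\<bar> * W i x)"
      by linarith
  qed (use W integrable_mult_K[OF gc] qgK in auto)
  also have "\<dots> = (\<Sum>i\<in>I. \<bar>l i - c\<bar> * (LINT x|circle_lebesgue. W i x))"
    using W by (subst Bochner_Integration.integral_sum) auto
  also have "\<dots> = 2 * pi * (\<Sum>i\<in>I. \<bar>l i - c\<bar>)"
    unfolding sum_distrib_left using I by (intro sum.cong refl) (auto simp: integral_W)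
  finally have "(LINT x|circle_lebesgue. \<bar>g x - c\<bar> * K x) -
      (LINT x|circle_lebesgue. \<bar>q x - g x * K x\<bar>) \<le> 2 * pi * (\<Sum>i\<in>I. \<bar>l i - c\<bar>)" .
  moreover have "(LINT x|circle_lebesgue. \<bar>q x - g x * K x\<bar>) \<le> fejer_oscillation n g / (2 * pi)"
    using defect by (simp add: pos_le_divide_eq mult.commute)
  ultimately show ?thesis by linarith
qed

text \<open>The oscillation term enters through the lower bound only; the Dirichlet term is the
  price of replacing \<open>K\<close> by the constant n / 2.\<close>

lemma mean_abs_deviation:
  "\<bar>2 * pi * (\<Sum>i\<in>I. \<bar>l i - c\<bar>) - n / 2 * (LINT x|circle_lebesgue. \<bar>g x - c\<bar>)\<bar> \<le>
    fejer_oscillation n g / (2 * pi) +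
    (LINT x|circle_lebesgue. \<bar>g x - c\<bar> * cmod (\<Sum>j<n. cis (real j * (2 * x)))) / 2"
proof -
  have gc: "integrable circle_lebesgue (\<lambda>x. \<bar>g x - c\<bar>)" using g by auto
  have D: "integrable circle_lebesgue (\<lambda>x. \<bar>g x - c\<bar> * cmod (\<Sum>j<n. cis (real j * (2 * x))))"
  proof (rule integrable_mult_cont[OF gc, where B = n])
    show "\<bar>cmod (\<Sum>j<n. cis (real j * (2 * x)))\<bar> \<le> real n" for x
      using norm_sum[of "\<lambda>j. cis (real j * (2 * x))" "{..<n}"] by simp
  qed (intro continuous_intros)
  have "\<bar>(LINT x|circle_lebesgue. \<bar>g x - c\<bar> * K x) - n / 2 * (LINT x|circle_lebesgue. \<bar>g x - c\<bar>)\<bar> =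
      \<bar>LINT x|circle_lebesgue. \<bar>g x - c\<bar> * (K x - n / 2)\<bar>"
    using gc integrable_mult_K[OF gc] by (simp add: right_diff_distrib mult_ac)
  also have "\<dots> \<le> (LINT x|circle_lebesgue. \<bar>\<bar>g x - c\<bar> * (K x - n / 2)\<bar>)" by (rule integral_abs_bound)
  also have "\<dots> \<le> (LINT x|circle_lebesgue. \<bar>g x - c\<bar> * cmod (\<Sum>j<n. cis (real j * (2 * x))) / 2)"
  proof (rule integral_mono)
    show "\<bar>\<bar>g x - c\<bar> * (K x - n / 2)\<bar> \<le> \<bar>g x - c\<bar> * cmod (\<Sum>j<n. cis (real j * (2 * x))) / 2" for x
      using mult_left_mono[OF K_approx[of x], of "\<bar>g x - c\<bar>"] by (simp add: abs_mult)
    show "integrable circle_lebesgue (\<lambda>x. \<bar>\<bar>g x - c\<bar> * (K x - n / 2)\<bar>)"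
      using gc integrable_mult_K[OF gc] by (simp add: right_diff_distrib)
  qed (use D in simp)
  finally have "\<bar>(LINT x|circle_lebesgue. \<bar>g x - c\<bar> * K x) - n / 2 * (LINT x|circle_lebesgue. \<bar>g x - c\<bar>)\<bar> \<le>
      (LINT x|circle_lebesgue. \<bar>g x - c\<bar> * cmod (\<Sum>j<n. cis (real j * (2 * x)))) / 2" by simp
  then show ?thesis using upper[of c] lower[of c] fejer_oscillation_nonneg[of n g] by linarith
qed

end

section \<open>Asymptotic distribution\<close>

text \<open>Dominated convergence: the Dirichlet sum over \<open>n\<close> is at most 1 everywhere,
  and for fixed x with sin x nonzero the sum itself is bounded in \<open>n\<close>. Only 0 and the
  endpoints are excluded.\<close>

lemma dirichlet_mean_tendsto:
  fixes h :: "real \<Rightarrow> real"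
  assumes h: "integrable circle_lebesgue h"
  shows "(\<lambda>n. (LINT x|circle_lebesgue. h x * cmod (\<Sum>j<n. cis (real j * (2 * x)))) / n) \<longlonglongrightarrow> 0"
proof -
  define D where "D n x = cmod (\<Sum>j<n. cis (real j * (2 * x)))" for n x
  have Dn: "D n x \<le> n" for n x
    using norm_sum[of "\<lambda>j. cis (real j * (2 * x))" "{..<n}"] by (simp add: D_def)
  have D0: "0 \<le> D n x" for n x by (simp add: D_def)
  have [measurable]: "D n \<in> borel_measurable circle_lebesgue" for n
    unfolding D_def by (intro continuous_measurable_circle continuous_intros)
  note [measurable] = borel_measurable_integrable[OF h]
  have ne0: "AE x in circle_lebesgue. x \<noteq> 0"
  proof -
    have "AE x in lebesgue. x \<noteq> (0 :: real)" by (intro AE_completion AE_lborel_singleton)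
    then have "AE x in lebesgue. x \<in> {-pi..pi} \<longrightarrow> x \<noteq> 0" by eventually_elim auto
    then show ?thesis by (rule AE_restrict_space_iff[THEN iffD2, rotated]) simp
  qed
  have "(\<lambda>n. LINT x|circle_lebesgue. h x * (D n x / n)) \<longlonglongrightarrow> (LINT x|circle_lebesgue. 0)"
  proof (rule integral_dominated_convergence[where w = "\<lambda>x. \<bar>h x\<bar>"])
    show "AE x in circle_lebesgue. (\<lambda>n. h x * (D n x / n)) \<longlonglongrightarrow> 0"
      using ne0 AE_circle_interior
    proof eventually_elim
      case (elim x)
      define d where "d = cmod (cis (2 * x) - cis 0)"
      have "sin x \<noteq> 0" using elim sin_eq_0_pi[of x] by auto
      then have "cos (2 * x) \<noteq> 1" by (simp add: cos_double_sin)
      then have d: "d > 0" by (auto simp: d_def complex_eq_iff)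
      have "D n x \<le> 2 / d" for n
        using cis_diff_mult_sum_le[of "2 * x" 0 n] d by (simp add: d_def D_def field_simps)
      then have le: "norm (D n x / n) \<le> (2 / d) / n" for n
        using divide_right_mono[OF \<open>\<And>n. D n x \<le> 2 / d\<close>, of "real n" n] D0 by simp
      have "(\<lambda>n. (2 / d) / real n) \<longlonglongrightarrow> 0"
        by (intro real_tendsto_divide_at_top[OF tendsto_const] filterlim_real_sequentially)
      then have "(\<lambda>n. D n x / n) \<longlonglongrightarrow> 0"
        by (rule Lim_null_comparison[rotated]) (use le in auto)
      then show ?case using tendsto_mult_right_zero by blast
    qed
    show "AE x in circle_lebesgue. norm (h x * (D n x / real n)) \<le> \<bar>h x\<bar>" for n
    proof (rule AE_I2)
      fix x
      have "\<bar>D n x / n\<bar> \<le> 1" using Dn[of n x] D0[of n x] by (auto simp: divide_le_eq_1)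
      then show "norm (h x * (D n x / real n)) \<le> \<bar>h x\<bar>" unfolding real_norm_def abs_mult by (intro mult_left_le) auto
    qed
  qed (use h in \<open>auto\<close>)
  then show ?thesis by (simp add: D_def)
qed

text \<open>The divisor \<open>n\<close> counts both parities while the sum runs over about half of
  the indices, hence 4 pi in place of 2 pi.\<close>

lemma parity_mean_abs_deviation_tendsto:
  fixes l :: "nat \<Rightarrow> nat \<Rightarrow> real"
  assumes "\<And>n. toeplitz_parity_eigenbasis n g (v n) (l n) s"
  shows "(\<lambda>n. (\<Sum>i | i < n \<and> (-1) ^ i = s. \<bar>l n i - c\<bar>) / n) \<longlonglongrightarrow>
    (LINT x|circle_lebesgue. \<bar>g x - c\<bar>) / (4 * pi)"
proof -
  interpret toeplitz_parity_eigenbasis n g "v n" "l n" s for n by fact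
  define S where "S n = (\<Sum>i | i < n \<and> (-1) ^ i = s. \<bar>l n i - c\<bar>)" for n :: nat
  define J where "J = (LINT x|circle_lebesgue. \<bar>g x - c\<bar>)"
  define D where "D n = (LINT x|circle_lebesgue. \<bar>g x - c\<bar> * cmod (\<Sum>j<n. cis (real j * (2 * x))))" for n :: nat
  have gc: "integrable circle_lebesgue (\<lambda>x. \<bar>g x - c\<bar>)" using g by auto
  have bound: "norm (2 * pi * (S n / n) - J / 2) \<le> (fejer_oscillation n g / n) / (2 * pi) + (D n / n) / 2"
    if "n > 0" for n
  proof -
    have "\<bar>2 * pi * S n - n / 2 * J\<bar> \<le> fejer_oscillation n g / (2 * pi) + D n / 2"
      using mean_abs_deviation[of n c] by (simp add: S_def J_def D_def I_def)
    then have "\<bar>2 * pi * S n - n / 2 * J\<bar> / n \<le> (fejer_oscillation n g / (2 * pi) + D n / 2) / n"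
      by (rule divide_right_mono) simp
    moreover have "\<bar>2 * pi * S n - n / 2 * J\<bar> / n = \<bar>(2 * pi * S n - n / 2 * J) / n\<bar>" by simp
    moreover have "(2 * pi * S n - n / 2 * J) / n = 2 * pi * (S n / n) - J / 2"
      using that by (simp add: field_simps)
    moreover have "(fejer_oscillation n g / (2 * pi) + D n / 2) / n =
        (fejer_oscillation n g / n) / (2 * pi) + (D n / n) / 2"
      by (simp add: add_divide_distrib mult.commute)
    ultimately show ?thesis by (simp only: real_norm_def)
  qed
  have "(\<lambda>n. (fejer_oscillation n g / n) / (2 * pi) + (D n / n) / 2) \<longlonglongrightarrow> 0 / (2 * pi) + 0 / 2"
    unfolding D_def by (intro tendsto_intros fejer_oscillation_tendsto g dirichlet_mean_tendsto gc) auto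
  then have lim: "(\<lambda>n. (fejer_oscillation n g / n) / (2 * pi) + (D n / n) / 2) \<longlonglongrightarrow> 0" by simp
  have "(\<lambda>n. 2 * pi * (S n / n) - J / 2) \<longlonglongrightarrow> 0"
    by (rule Lim_null_comparison[OF _ lim])
      (use bound in \<open>auto simp: eventually_sequentially intro!: exI[of _ "1 :: nat"]\<close>)
  then have "(\<lambda>n. 2 * pi * (S n / n)) \<longlonglongrightarrow> J / 2" by (simp add: LIM_zero_iff)
  then have "(\<lambda>n. 2 * pi * (S n / n) / (2 * pi)) \<longlonglongrightarrow> (J / 2) / (2 * pi)"
    by (intro tendsto_divide tendsto_const) auto
  then show ?thesis by (simp add: S_def J_def)
qed

text \<open>The tent of height 1 on [-1, 1], written as half the second difference of the absolute
  value so that it is a combination of functions |t - c|.\<close>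

definition hat :: "real \<Rightarrow> real" where "hat t = (\<bar>t - 1\<bar> - 2 * \<bar>t\<bar> + \<bar>t + 1\<bar>) / 2"

text \<open>Only the two nodes around \<open>t\<close> have nonzero hats there, with weights 1 - u
  and u. The interpolant is thus a convex combination of values of \<open>F\<close> within distance
  \<open>h\<close> of \<open>t\<close>.\<close>

lemma hat_interpolation_error:
  fixes F :: "real \<Rightarrow> complex"
  assumes h: "h > 0" and supp: "\<And>k. \<bar>k\<bar> > M \<Longrightarrow> F (of_int k * h) = 0"
    and close: "\<And>x y. \<bar>x - y\<bar> \<le> h \<Longrightarrow> cmod (F x - F y) \<le> e"
  shows "cmod (F t - (\<Sum>k\<in>{-M..M}. F (of_int k * h) * of_real (hat (t / h - of_int k)))) \<le> e"
proof -
  define m where "m = \<lfloor>t / h\<rfloor>"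
  define u where "u = t / h - of_int m"
  have u: "0 \<le> u" "u < 1" unfolding u_def m_def by linarith+
  have t: "t = (of_int m + u) * h" using h by (simp add: u_def)
  have hat: "hat (t / h - of_int k) = (if k = m then 1 - u else if k = m + 1 then u else 0)" for k
  proof -
    have eq: "t / h - of_int k = u - of_int (k - m)" by (simp add: u_def)
    consider "k = m" | "k = m + 1" | "k - m \<ge> 2" | "k - m \<le> -1" by linarith
    then show ?thesis
    proof cases
      case 1
      then have e: "t / h - of_int k = u" by (simp add: u_def)
      show ?thesis unfolding e hat_def using 1 u by (simp add: abs_if)
    next
      case 2
      then have e: "t / h - of_int k = u - 1" by (simp add: u_def)
      show ?thesis unfolding e hat_def using 2 u by (simp add: abs_if)
    next
      case 3
      then have "real_of_int (k - m) \<ge> 2" by linarith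
      then show ?thesis using u 3 unfolding eq hat_def by (auto simp: abs_if)
    next
      case 4
      then have "real_of_int (k - m) \<le> -1" by linarith
      then show ?thesis using u 4 unfolding eq hat_def by (auto simp: abs_if)
    qed
  qed
  \<comment> \<open>The two nodes around \<open>t\<close> may fall outside the range of summation;
    they can be added because \<open>F\<close> vanishes at them in that case.\<close>
  have "(\<Sum>k\<in>{-M..M}. F (of_int k * h) * of_real (hat (t / h - of_int k))) =
      (\<Sum>k\<in>{-M..M} \<union> {m, m + 1}. F (of_int k * h) * of_real (hat (t / h - of_int k)))"
    using supp[of m] supp[of "m + 1"] by (intro sum.mono_neutral_left) auto
  also have "\<dots> = (\<Sum>k\<in>{m, m + 1}. F (of_int k * h) * of_real (hat (t / h - of_int k)))"
    by (intro sum.mono_neutral_right) (auto simp: hat)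
  also have "\<dots> = F (of_int m * h) * of_real (1 - u) + F (of_int (m + 1) * h) * of_real u"
    by (simp add: hat)
  finally have "F t - (\<Sum>k\<in>{-M..M}. F (of_int k * h) * of_real (hat (t / h - of_int k))) =
      (F t - F (of_int m * h)) * of_real (1 - u) + (F t - F (of_int (m + 1) * h)) * of_real u"
    by (simp add: algebra_simps)
  also have "cmod \<dots> \<le> cmod (F t - F (of_int m * h)) * (1 - u) + cmod (F t - F (of_int (m + 1) * h)) * u"
    using u by (intro order_trans[OF norm_triangle_ineq]) (simp add: norm_mult del: of_real_diff)
  also have "\<dots> \<le> e * (1 - u) + e * u"
  proof (intro add_mono mult_right_mono close)
    have "t - of_int m * h = u * h" "t - of_int (m + 1) * h = - ((1 - u) * h)"
      by (simp_all add: t algebra_simps)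
    then show "\<bar>t - of_int m * h\<bar> \<le> h" "\<bar>t - of_int (m + 1) * h\<bar> \<le> h"
      using u h by (auto simp: abs_mult intro: mult_left_le_one_le)
  qed (use u in auto)
  also have "\<dots> = e" by (simp add: algebra_simps)
  finally show ?thesis .
qed

text \<open>\<open>F\<close> is uniformly close to a piecewise linear interpolant, for which
  convergence follows from \<open>dev\<close> by linearity; a uniform error passes unchanged to both
  averages.\<close>

lemma mean_abs_deviation_imp_distribution:
  fixes l :: "nat \<Rightarrow> 'i \<Rightarrow> real" and F :: "real \<Rightarrow> complex"
  assumes g: "integrable circle_lebesgue g"
    and dev: "\<And>c. (\<lambda>n. (\<Sum>i\<in>J n. \<bar>l n i - c\<bar>) / card (J n)) \<longlonglongrightarrow>
      (LINT x|circle_lebesgue. \<bar>g x - c\<bar>) / (2 * pi)"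
    and F: "continuous_on UNIV F" "\<And>t. \<bar>t\<bar> > B \<Longrightarrow> F t = 0"
  shows "(\<lambda>n. (\<Sum>i\<in>J n. F (l n i)) / of_nat (card (J n))) \<longlonglongrightarrow>
    (LINT x|circle_lebesgue. F (g x)) / of_real (2 * pi)"
proof -
  note [measurable] = borel_measurable_integrable[OF g] borel_measurable_continuous_onI[OF F(1)]
  define avg where "avg G n = (\<Sum>i\<in>J n. G (l n i)) / of_nat (card (J n))" for G :: "real \<Rightarrow> complex" and n
  define lim where "lim G = (LINT x|circle_lebesgue. G (g x)) / of_real (2 * pi)" for G :: "real \<Rightarrow> complex"
  have "\<exists>H. avg H \<longlonglongrightarrow> lim H \<and> integrable circle_lebesgue (\<lambda>x. H (g x)) \<and> (\<forall>t. cmod (F t - H t) \<le> e)"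
    if "e > 0" for e
  proof -
    \<comment> \<open>The margin 1 exceeds or equals the mesh: two points at distance at most
      \<open>h\<close> either both lie in this interval or both lie where \<open>F\<close>
      vanishes.\<close>
    have "uniformly_continuous_on {-B-1..B+1} F"
      by (intro compact_uniformly_continuous continuous_on_subset[OF F(1)]) auto
    then obtain d where d: "d > 0"
      "\<And>x y. x \<in> {-B-1..B+1} \<Longrightarrow> y \<in> {-B-1..B+1} \<Longrightarrow> dist x y < d \<Longrightarrow> dist (F x) (F y) < e"
      unfolding uniformly_continuous_on_def using \<open>e > 0\<close> by metis
    define h where "h = min (d / 2) 1"
    have h: "h > 0" "h < d" "h \<le> 1" using d(1) by (auto simp: h_def)
    have close: "cmod (F x - F y) \<le> e" if "\<bar>x - y\<bar> \<le> h" for x y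
    proof (cases "x \<in> {-B-1..B+1} \<and> y \<in> {-B-1..B+1}")
      case True
      then show ?thesis using d(2)[of x y] that h by (auto simp: dist_norm)
    next
      case False
      then have "\<bar>x\<bar> > B" "\<bar>y\<bar> > B" using that h by auto
      then show ?thesis using F(2) \<open>e > 0\<close> by simp
    qed
    \<comment> \<open>Every node \<open>k * h\<close> with |k| > M lies outside [-B, B].\<close>
    define M where "M = \<lceil>B / h\<rceil>"
    define H where "H t = (\<Sum>k\<in>{-M..M}. F (of_int k * h) * of_real (hat (t / h - of_int k)))" for t
    have supp: "F (of_int k * h) = 0" if "\<bar>k\<bar> > M" for k
    proof (rule F(2))
      have "B / h < of_int \<bar>k\<bar>" using that unfolding M_def by linarith
      then show "B < \<bar>of_int k * h\<bar>" using h by (simp add: abs_mult pos_divide_less_eq)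
    qed
    have err: "cmod (F t - H t) \<le> e" for t
      unfolding H_def
      by (rule hat_interpolation_error[where M = M and F = F and h = h and e = e], fact h(1), erule supp, erule close)
    have hat: "hat (t / h - of_int k) = (\<bar>t - (of_int k * h + h)\<bar> - 2 * \<bar>t - of_int k * h\<bar> + \<bar>t - (of_int k * h - h)\<bar>) / (2 * h)"
      for t k
    proof -
      have "\<bar>t - (of_int k * h + h)\<bar> = h * \<bar>t / h - of_int k - 1\<bar>"
        "\<bar>t - of_int k * h\<bar> = h * \<bar>t / h - of_int k\<bar>"
        "\<bar>t - (of_int k * h - h)\<bar> = h * \<bar>t / h - of_int k + 1\<bar>"
        using h(1) by (simp_all add: abs_mult_pos' algebra_simps)
      then show ?thesis using h(1) by (simp add: hat_def field_simps)
    qed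
    have int: "integrable circle_lebesgue (\<lambda>x. hat (g x / h - of_int k))" for k
      unfolding hat using g by auto
    have hat_lim: "(\<lambda>n. (\<Sum>i\<in>J n. hat (l n i / h - of_int k)) / card (J n)) \<longlonglongrightarrow>
        (LINT x|circle_lebesgue. hat (g x / h - of_int k)) / (2 * pi)" for k
    proof -
      let ?A = "\<lambda>c n. (\<Sum>i\<in>J n. \<bar>l n i - c\<bar>) / card (J n)"
      let ?L = "\<lambda>c. (LINT x|circle_lebesgue. \<bar>g x - c\<bar>) / (2 * pi)"
      let ?a = "of_int k * h :: real"
      have "(\<lambda>n. (?A (?a + h) n - 2 * ?A ?a n + ?A (?a - h) n) / (2 * h)) \<longlonglongrightarrow>
          (?L (?a + h) - 2 * ?L ?a + ?L (?a - h)) / (2 * h)"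
        using h(1) by (intro tendsto_intros dev) auto
      moreover have "(\<lambda>n. (?A (?a + h) n - 2 * ?A ?a n + ?A (?a - h) n) / (2 * h)) =
          (\<lambda>n. (\<Sum>i\<in>J n. hat (l n i / h - of_int k)) / card (J n))"
        unfolding hat
        by (simp add: sum.distrib sum_subtractf add_divide_distrib diff_divide_distrib mult_ac
            flip: sum_divide_distrib sum_distrib_left)
      moreover have "(?L (?a + h) - 2 * ?L ?a + ?L (?a - h)) / (2 * h) =
          (LINT x|circle_lebesgue. hat (g x / h - of_int k)) / (2 * pi)"
        unfolding hat using g by (simp add: add_divide_distrib diff_divide_distrib mult_ac)
      ultimately show ?thesis by simp
    qed
    have "avg H = (\<lambda>n. \<Sum>k\<in>{-M..M}. F (of_int k * h) * of_real ((\<Sum>i\<in>J n. hat (l n i / h - of_int k)) / card (J n)))"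
      unfolding avg_def H_def
      by (subst sum.swap) (simp add: sum_distrib_left sum_divide_distrib fun_eq_iff)
    moreover have "lim H = (\<Sum>k\<in>{-M..M}. F (of_int k * h) * of_real ((LINT x|circle_lebesgue. hat (g x / h - of_int k)) / (2 * pi)))"
      unfolding lim_def H_def using int
      by (simp add: Bochner_Integration.integral_sum sum_divide_distrib)
    moreover have "(\<lambda>n. \<Sum>k\<in>{-M..M}. F (of_int k * h) * of_real ((\<Sum>i\<in>J n. hat (l n i / h - of_int k)) / card (J n))) \<longlonglongrightarrow>
       (\<Sum>k\<in>{-M..M}. F (of_int k * h) * of_real ((LINT x|circle_lebesgue. hat (g x / h - of_int k)) / (2 * pi)))"
      by (intro tendsto_intros hat_lim)
    ultimately have "avg H \<longlonglongrightarrow> lim H" by simp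
    moreover have "integrable circle_lebesgue (\<lambda>x. H (g x))"
      unfolding H_def using int by auto
    ultimately show ?thesis using err by blast
  qed note approx = this
  have "avg F \<longlonglongrightarrow> lim F"
  proof (rule LIMSEQ_I)
    \<comment> \<open>Three errors of at most e/4 each leave a strict inequality.\<close>
    fix e :: real assume "e > 0"
    then have "e / 4 > 0" by simp
    from approx[OF this] obtain H where H: "avg H \<longlonglongrightarrow> lim H" "integrable circle_lebesgue (\<lambda>x. H (g x))"
      "\<And>t. cmod (F t - H t) \<le> e / 4" by blast
    \<comment> \<open>The composition differs from the integrable one with \<open>H\<close> by a
      bounded function, and the measure is finite.\<close>
    have Fint: "integrable circle_lebesgue (\<lambda>x. F (g x))"
    proof -
      have "integrable circle_lebesgue (\<lambda>x. F (g x) - H (g x))"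
        by (rule circle.integrable_const_bound[where B = "e / 4"])
          (use H(3) borel_measurable_integrable[OF H(2)] in auto)
      from Bochner_Integration.integrable_add[OF this H(2)] show ?thesis by simp
    qed
    have avg: "cmod (avg F n - avg H n) \<le> e / 4" for n
    proof (cases "card (J n) = 0")
      \<comment> \<open>Both averages are 0 here, because division by 0 yields 0.\<close>
      case True then show ?thesis using \<open>e > 0\<close> by (simp add: avg_def)
    next
      case False
      have "cmod (\<Sum>i\<in>J n. F (l n i) - H (l n i)) \<le> (\<Sum>i\<in>J n. e / 4)"
        by (rule order_trans[OF norm_sum sum_mono[OF H(3)]])
      then show ?thesis using False unfolding avg_def
        by (simp add: norm_divide field_simps flip: diff_divide_distrib sum_subtractf)
    qed
    have lim: "cmod (lim F - lim H) \<le> e / 4"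
    proof -
      have "cmod (LINT x|circle_lebesgue. F (g x) - H (g x)) \<le> (LINT x|circle_lebesgue. e / 4)"
        by (rule order_trans[OF integral_norm_bound integral_mono]) (use Fint H in auto)
      then have "cmod ((LINT x|circle_lebesgue. F (g x)) - (LINT x|circle_lebesgue. H (g x))) \<le> 2 * pi * (e / 4)"
        using Fint H(2) by (simp only: integral_const_circle Bochner_Integration.integral_diff)
      then show ?thesis unfolding lim_def
        by (simp add: norm_divide norm_mult field_simps flip: diff_divide_distrib)
    qed
    obtain N where N: "\<And>n. n \<ge> N \<Longrightarrow> cmod (avg H n - lim H) < e / 4"
      using LIMSEQ_D[OF H(1) \<open>e / 4 > 0\<close>] by blast
    show "\<exists>N. \<forall>n\<ge>N. norm (avg F n - lim F) < e"
    proof (intro exI[of _ N] allI impI)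
      fix n assume "N \<le> n"
      have "avg F n - lim F = (avg F n - avg H n) + (avg H n - lim H) - (lim F - lim H)" by simp
      also have "cmod \<dots> \<le> cmod (avg F n - avg H n) + cmod (avg H n - lim H) + cmod (lim F - lim H)"
        by (metis add_right_mono norm_triangle_ineq norm_triangle_ineq4 order_trans)
      also have "\<dots> < e" using avg[of n] N[OF \<open>N \<le> n\<close>] lim \<open>e > 0\<close> by linarith
      finally show "norm (avg F n - lim F) < e" .
    qed
  qed
  then show ?thesis unfolding avg_def[abs_def] lim_def .
qed

section \<open>Toeplitz matrices\<close>

text \<open>For square matrices a right inverse is also a left inverse, so orthonormal rows give
  orthonormal columns.\<close>

lemma orthonormal_rows_complete:
  fixes v :: "nat \<Rightarrow> nat \<Rightarrow> real"
  assumes orth: "\<And>i k. i < n \<Longrightarrow> k < n \<Longrightarrow> (\<Sum>j<n. v i j * v k j) = (if i = k then 1 else 0)"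
    and jk: "j < n" "k < n"
  shows "(\<Sum>i<n. v i j * v i k) = (if j = k then 1 else 0)"
proof -
  define A B where "A = mat n n (\<lambda>(i, j). v i j)" and "B = mat n n (\<lambda>(j, i). v i j)"
  have AB: "A \<in> carrier_mat n n" "B \<in> carrier_mat n n" by (auto simp: A_def B_def)
  have "A * B = 1\<^sub>m n"
    by (rule eq_matI) (auto simp: A_def B_def scalar_prod_def orth atLeast0LessThan)
  then have "B * A = 1\<^sub>m n" using mat_mult_left_right_inverse[OF AB] by simp
  then have "(B * A) $$ (j, k) = 1\<^sub>m n $$ (j, k)" by simp
  then show ?thesis using jk by (simp add: A_def B_def scalar_prod_def atLeast0LessThan)
qed

section \<open>Eigenvalues with multiplicity from a unitary diagonalization\<close>

lemma proots_prod_linear_factors: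
  fixes f :: "'b \<Rightarrow> 'a::idom"
  shows "proots (\<Prod>x\<leftarrow>xs. [:- f x, 1:]) = image_mset f (mset xs)"
proof (induction xs)
  case (Cons x xs)
  have "(\<Prod>x\<leftarrow>xs. [:- f x, 1:]) \<noteq> 0" by (auto simp: prod_list_zero_iff)
  then have "proots ([:- f x, 1:] * (\<Prod>x\<leftarrow>xs. [:- f x, 1:])) =
      proots [:- f x, 1:] + proots (\<Prod>x\<leftarrow>xs. [:- f x, 1:])"
    by (intro proots_mult) auto
  then show ?case using Cons by simp
qed simp

text \<open>Unitary conjugation is a similarity and keeps the characteristic polynomial, which for a
  diagonal matrix splits into the linear factors of its entries. This accounts for multiplicities as
  well.\<close>

lemma eigenvalue_ordering_unitary_diag:
  assumes V: "real_unitary_mat n V" and A: "A = V * diag_from_1 n d * mat_adjoint V"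
  shows "eigenvalue_ordering A d"
proof -
  let ?D = "diag_from_1 n d"
  have Vc: "V \<in> carrier_mat n n" and VV: "V * mat_adjoint V = 1\<^sub>m n" "mat_adjoint V * V = 1\<^sub>m n"
    using V by (auto simp: real_unitary_mat_def)
  have ac: "mat_adjoint V \<in> carrier_mat n n" using Vc by (auto simp: mat_adjoint_def)
  have D: "?D \<in> carrier_mat n n" by (simp add: diag_from_1_def)
  have Ac: "A \<in> carrier_mat n n" using A Vc ac D by auto
  have "similar_mat_wit A ?D V (mat_adjoint V)"
    using Ac Vc ac D VV A by (intro similar_mat_witI) auto
  then have "char_poly A = char_poly ?D"
    by (intro char_poly_similar) (auto simp: similar_mat_def)
  also have "\<dots> = (\<Prod>a\<leftarrow>diag_mat ?D. [:- a, 1:])"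
    using D by (intro char_poly_upper_triangular) (auto simp: diag_from_1_def mat_diag_def)
  also have "diag_mat ?D = map (\<lambda>i. d (i + 1)) [0..<n]"
    by (auto simp: diag_mat_def diag_from_1_def mat_diag_def)
  finally have "eigenvalues_mset A = proots (\<Prod>i\<leftarrow>[0..<n]. [:- d (i + 1), 1:])"
    unfolding eigenvalues_mset_def by (simp add: o_def)
  also have "\<dots> = image_mset (\<lambda>i. d (i + 1)) (mset [0..<n])"
    by (rule proots_prod_linear_factors)
  also have "\<dots> = image_mset d (image_mset Suc (mset_set {0..<n}))"
    by (simp add: image_mset.compositionality o_def)
  also have "image_mset Suc (mset_set {0..<n}) = mset_set {1..n}"
    by (subst image_mset_mset_set) (auto simp: image_Suc_atLeastLessThan atLeastLessThanSuc_atLeastAtMost)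
  finally show ?thesis using Ac by (simp add: eigenvalue_ordering_def family_mset_def)
qed

lemma mat_adjoint_real:
  "mat_adjoint (mat n n (\<lambda>(j, i). complex_of_real (v i j))) = mat n n (\<lambda>(i, j). complex_of_real (v i j))"
  by (rule eq_matI) (auto simp: mat_adjoint_def mat_of_rows_def cols_def)

text \<open>The sum of rank-one terms for the matrix with columns \<open>v i\<close>. It reduces
  each matrix identity of the theorem to an identity of sums.\<close>

lemma conjugated_diag:
  "mat n n (\<lambda>(j, i). complex_of_real (v i j)) * diag_from_1 n d * mat n n (\<lambda>(i, j). complex_of_real (v i j)) =
    mat n n (\<lambda>(j, k). \<Sum>i<n. d (i + 1) * of_real (v i j * v i k))"
proof (rule eq_matI)
  fix j k assume jk: "j < dim_row (mat n n (\<lambda>(j, k). \<Sum>i<n. d (i + 1) * complex_of_real (v i j * v i k)))"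
    "k < dim_col (mat n n (\<lambda>(j, k). \<Sum>i<n. d (i + 1) * complex_of_real (v i j * v i k)))"
  have "(mat n n (\<lambda>(j, i). complex_of_real (v i j)) * diag_from_1 n d) =
      mat n n (\<lambda>(j, i). d (i + 1) * complex_of_real (v i j))"
    unfolding diag_from_1_def by (subst mat_diag_mult_right[of _ n]) (auto simp: mult.commute)
  then show "(mat n n (\<lambda>(j, i). complex_of_real (v i j)) * diag_from_1 n d *
      mat n n (\<lambda>(i, j). complex_of_real (v i j))) $$ (j, k) =
      mat n n (\<lambda>(j, k). \<Sum>i<n. d (i + 1) * complex_of_real (v i j * v i k)) $$ (j, k)"
    using jk by (simp add: scalar_prod_def atLeast0LessThan mult.assoc)
qed (auto simp: diag_from_1_def)

lemma family_mset_size [simp]: "size (family_mset m d) = m"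
  by (simp add: family_mset_def)

lemma sum_family_mset: "(\<Sum>z\<in>#family_mset m d. F z) = (\<Sum>i\<in>{1..m}. F (d i))"
  by (simp add: family_mset_def image_mset.compositionality o_def sum_unfold_sum_mset)

lemma family_mset_cong: "(\<And>i. i \<in> {1..m} \<Longrightarrow> d i = d' i) \<Longrightarrow> family_mset m d = family_mset m d'"
  unfolding family_mset_def by (intro image_mset_cong) auto

section \<open>Fourier coefficients of real even functions\<close>

lemma AE_eq_Re:
  "AE x in M. f x \<in> \<real> \<Longrightarrow> AE x in M. f x = complex_of_real (Re (f x))"
  by (erule eventually_mono) (simp add: complex_is_Real_iff complex_eq_iff)

lemma fourier_coeff_eq_integral_cis:
  assumes L1: "integrable circle_lebesgue f" and real: "AE x in circle_lebesgue. f x \<in> \<real>"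
  shows "fourier_coeff f k =
    (LINT x|circle_lebesgue. of_real (Re (f x)) * cis (of_int (- k) * x)) / of_real (2 * pi)"
proof -
  note [measurable] = borel_measurable_integrable[OF L1]
  have [measurable]: "(\<lambda>x. cis (of_int (- k) * x)) \<in> borel_measurable circle_lebesgue"
    by (intro continuous_measurable_circle continuous_intros)
  have exp: "exp (- \<i> * of_int k * of_real x) = cis (of_int (- k) * x)" for x
    by (simp add: cis_conv_exp mult_ac)
  have "(LINT x|circle_lebesgue. f x * cis (of_int (- k) * x)) =
      (LINT x|circle_lebesgue. of_real (Re (f x)) * cis (of_int (- k) * x))"
  proof (rule integral_cong_AE)
    show "AE x in circle_lebesgue. f x * cis (of_int (- k) * x) = of_real (Re (f x)) * cis (of_int (- k) * x)"
      using AE_eq_Re[OF real] by eventually_elim simp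
  qed measurable
  then show ?thesis unfolding fourier_coeff_def exp by simp
qed

text \<open>Evenness makes the coefficients at k and -k equal, realness makes them conjugate;
  together they are real.\<close>

lemma fourier_coeff_real_even:
  assumes L1: "integrable circle_lebesgue f" and real: "AE x in circle_lebesgue. f x \<in> \<real>"
    and even: "AE x in circle_lebesgue. f (- x) = f x"
  shows "fourier_coeff f k = of_real (Re (fourier_coeff f k))" "fourier_coeff f (- k) = fourier_coeff f k"
proof -
  define g where "g x = Re (f x)" for x
  have g: "integrable circle_lebesgue g" unfolding g_def using L1 by auto
  note [measurable] = borel_measurable_integrable[OF g]
  have [measurable]: "(\<lambda>x. g (- x)) \<in> borel_measurable circle_lebesgue"
    using integrable_reflect_real[of pi "-pi" g] g by (intro borel_measurable_integrable) simp
  have [measurable]: "(\<lambda>x. cis (of_int k * x)) \<in> borel_measurable circle_lebesgue" for k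
    by (intro continuous_measurable_circle continuous_intros)
  define c where "c k = (LINT x|circle_lebesgue. of_real (g x) * cis (of_int k * x))" for k
  have f: "fourier_coeff f k = c (- k) / of_real (2 * pi)" for k
    unfolding c_def g_def by (rule fourier_coeff_eq_integral_cis[OF L1 real])
  have "c (- k) = c k" for k
  proof -
    have "c (- k) = (LINT x|circle_lebesgue. of_real (g (- x)) * cis (of_int (- k) * (- x)))"
      unfolding c_def
      using integral_reflect_real[of pi "-pi" "\<lambda>x. of_real (g x) * cis (of_int (- k) * x)"] by simp
    also have "\<dots> = (LINT x|circle_lebesgue. of_real (g (- x)) * cis (of_int k * x))" by simp
    also have "\<dots> = c k" unfolding c_def
    proof (rule integral_cong_AE)
      show "AE x in circle_lebesgue. of_real (g (- x)) * cis (of_int k * x) = of_real (g x) * cis (of_int k * x)"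
        using even by eventually_elim (simp add: g_def)
    qed measurable
    finally show ?thesis .
  qed
  moreover have "cnj (c k) = c (- k)" for k
  proof -
    have "cnj (c k) = (LINT x|circle_lebesgue. cnj (of_real (g x) * cis (of_int k * x)))"
      unfolding c_def by (rule Bochner_Integration.integral_cnj[symmetric])
    then show ?thesis by (simp add: c_def cis_cnj)
  qed
  ultimately have "cnj (c k) = c k" "c (- k) = c k" for k by auto
  then show "fourier_coeff f k = of_real (Re (fourier_coeff f k))" "fourier_coeff f (- k) = fourier_coeff f k"
    unfolding f by (auto simp: complex_eq_iff)
qed

text \<open>\<open>v\<close> and \<open>l\<close> are chosen before \<open>s\<close>: both parities
  have to come from one eigenbasis, which becomes the matrix \<open>V\<close>.\<close>

lemma ex_toeplitz_parity_eigenbasis: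
  assumes L1: "integrable circle_lebesgue f" and real: "AE x in circle_lebesgue. f x \<in> \<real>"
    and even: "AE x in circle_lebesgue. f (- x) = f x"
  shows "\<exists>v l. (\<forall>s. s = 1 \<or> s = -1 \<longrightarrow> toeplitz_parity_eigenbasis n (\<lambda>x. Re (f x)) v l s) \<and>
    (\<forall>j<n. \<forall>k<n. fourier_coeff f (int j - int k) = of_real (\<Sum>i<n. l i * v i j * v i k))"
proof -
  define T where "T j k = Re (fourier_coeff f (int j - int k))" for j k :: nat
  note real_even = fourier_coeff_real_even[OF L1 real even]
  have sym: "T j k = T k j" for j k using real_even(2)[of "int j - int k"] by (simp add: T_def)
  have centro: "T (n - 1 - j) (n - 1 - k) = T j k" if "j < n" "k < n" for j k
  proof -
    have "int (n - 1 - j) - int (n - 1 - k) = int k - int j" using that by auto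
    then show ?thesis using sym by (simp add: T_def)
  qed
  have "\<exists>v l. (\<forall>i<n. \<forall>k<n. (\<Sum>j<n. v i j * v k j) = (if i = k then 1 else 0)) \<and>
      (\<forall>i<n. \<forall>j<n. (\<Sum>k<n. T j k * v i k) = l i * v i j) \<and>
      (\<forall>i<n. \<forall>j<n. v i (n - 1 - j) = (-1) ^ i * v i j)"
    by (rule parity_eigenbasis; (rule sym | rule centro; assumption))
  then obtain v l where
    orth': "\<forall>i<n. \<forall>k<n. (\<Sum>j<n. v i j * v k j) = (if i = k then 1 else 0)" and
    ev': "\<forall>i<n. \<forall>j<n. (\<Sum>k<n. T j k * v i k) = l i * v i j" and
    par': "\<forall>i<n. \<forall>j<n. v i (n - 1 - j) = (-1) ^ i * v i j"
    by blast
  note orth = orth'[rule_format] and ev = ev'[rule_format] and par = par'[rule_format]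
  note complete = orthonormal_rows_complete[OF orth]
  have T: "T j k = (\<Sum>i<n. l i * v i j * v i k)" if jk: "j < n" "k < n" for j k
  proof -
    \<comment> \<open>The identity matrix is inserted and replaced by the completeness relation,
      which brings in the eigenvalue equation.\<close>
    have "T j k = (\<Sum>m<n. T j m * (if m = k then 1 else 0))"
      using jk by (simp add: if_distrib[of "\<lambda>x. _ * x"] cong: if_cong)
    also have "\<dots> = (\<Sum>m<n. T j m * (\<Sum>i<n. v i m * v i k))"
      using jk complete by (intro sum.cong refl) auto
    also have "\<dots> = (\<Sum>i<n. (\<Sum>m<n. T j m * v i m) * v i k)"
      unfolding sum_distrib_left sum_distrib_right by (subst sum.swap) (simp add: mult_ac)
    also have "\<dots> = (\<Sum>i<n. l i * v i j * v i k)" using ev jk by (intro sum.cong refl) auto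
    finally show ?thesis .
  qed
  have F: "fourier_coeff f (int j - int k) = of_real (\<Sum>i<n. l i * v i j * v i k)" if "j < n" "k < n" for j k
    using T[OF that] real_even(1)[of "int j - int k"] by (simp add: T_def)
  have "toeplitz_parity_eigenbasis n (\<lambda>x. Re (f x)) v l s" if "s = 1 \<or> s = -1" for s
  proof
    show "integrable circle_lebesgue (\<lambda>x. Re (f x))" using L1 by auto
    show "AE x in circle_lebesgue. Re (f (- x)) = Re (f x)" using even by eventually_elim simp
    fix j k assume jk: "j < n" "k < n"
    show "(LINT y|circle_lebesgue. of_real (Re (f y)) * cis (of_int (int k - int j) * y)) =
        of_real (2 * pi * (\<Sum>i<n. l i * v i j * v i k))"
      using F[OF jk] unfolding fourier_coeff_eq_integral_cis[OF L1 real]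
      by (simp add: field_simps)
  qed (use that orth par complete in auto)
  then show ?thesis using F by blast
qed

text \<open>The map \<open>p\<close> enumerates the indices of one parity, and \<open>m\<close>
  makes them asymptotically half of all indices. The sign \<open>\<sigma>\<close> turns eigenvalues
  of the Toeplitz matrix into those of the flipped one.\<close>

lemma asymp_distributed_parity_eigenvalues:
  fixes p :: "nat \<Rightarrow> nat" and \<sigma> :: real
  assumes L1: "integrable circle_lebesgue f" and real: "AE x in circle_lebesgue. f x \<in> \<real>"
    and basis: "\<And>n. toeplitz_parity_eigenbasis n (\<lambda>x. Re (f x)) (v n) (l n) s"
    and bij: "\<And>n. bij_betw p {1..m n} {i. i < n \<and> (-1) ^ i = s}"
    and m: "\<And>n. \<bar>real (m n) - n / 2\<bar> \<le> 1"
    and \<sigma>: "\<sigma> = 1 \<or> \<sigma> = -1"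
  shows "asymp_distributed (\<lambda>n. family_mset (m n) (\<lambda>i. of_real (\<sigma> * l n (p i)))) {-pi..pi} (\<lambda>x. of_real \<sigma> * f x)"
  unfolding asymp_distributed_def
proof (intro conjI allI impI)
  have m_lim: "(\<lambda>n. real (m n) / n) \<longlonglongrightarrow> 1 / 2"
  proof -
    have "(\<lambda>n. 1 / real n) \<longlonglongrightarrow> 0" by (rule lim_1_over_n)
    moreover have "norm (real (m n) / n - 1 / 2) \<le> 1 / n" if "n > 0" for n
    proof -
      have "real (m n) / n - 1 / 2 = (real (m n) - n / 2) / n" using that by (simp add: field_simps)
      then show ?thesis using m[of n] that by (simp add: divide_right_mono)
    qed
    ultimately have "(\<lambda>n. real (m n) / n - 1 / 2) \<longlonglongrightarrow> 0"
      by (intro Lim_null_comparison[of "\<lambda>n. real (m n) / n - 1 / 2"])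
        (auto simp: eventually_sequentially intro!: exI[of _ "1 :: nat"])
    then show ?thesis by (simp add: LIM_zero_iff)
  qed
  show "filterlim (\<lambda>n. size (family_mset (m n) (\<lambda>i. complex_of_real (\<sigma> * l n (p i))))) at_top sequentially"
    unfolding family_mset_size filterlim_at_top eventually_sequentially
  proof (intro allI exI[of _ "2 * N + 2" for N] impI)
    \<comment> \<open>With this threshold the lower bound n/2 - 1 for \<open>m n\<close> is at least
      \<open>N\<close>.\<close>
    fix N n :: nat assume "2 * N + 2 \<le> n"
    then have "real N \<le> n / 2 - 1" by linarith
    then show "N \<le> m n" using m[of n] by linarith
  qed
  show "{- pi..pi} \<in> sets lebesgue" by simp
  show "0 < emeasure lebesgue {- pi..pi}" by simp
  show "emeasure lebesgue {- pi..pi} < \<infinity>" by simp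
  note [measurable] = borel_measurable_integrable[OF L1]
  show "(\<lambda>x. of_real \<sigma> * f x) \<in> borel_measurable circle_lebesgue" by measurable
  fix F :: "complex \<Rightarrow> complex" assume F: "continuous_on UNIV F \<and> bounded {z. F z \<noteq> 0}"
  note [measurable] = borel_measurable_continuous_onI[OF conjunct1[OF F]]
  obtain B where B: "\<And>z. F z \<noteq> 0 \<Longrightarrow> cmod z \<le> B" using F by (auto simp: bounded_iff)
  \<comment> \<open>The sign is moved into the test function, so that the real result for
    \<open>l\<close> and the real part of \<open>f\<close> applies.\<close>
  define G where "G t = F (of_real (\<sigma> * t))" for t :: real
  define J where "J n = {i. i < n \<and> (-1) ^ i = s}" for n :: nat
  have card: "card (J n) = m n" for n using bij_betw_same_card[OF bij[of n]] by (simp add: J_def)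
  have g: "integrable circle_lebesgue (\<lambda>x. Re (f x))" using L1 by auto
  have "(\<lambda>n. (\<Sum>i\<in>J n. G (l n i)) / of_nat (card (J n))) \<longlonglongrightarrow>
      (LINT x|circle_lebesgue. G (Re (f x))) / of_real (2 * pi)"
  proof (rule mean_abs_deviation_imp_distribution[OF g, where B = B])
    fix c :: real
    \<comment> \<open>Passing from the divisor \<open>n\<close> to the number of indices divides by
      the limit 1/2 and turns 4 pi into 2 pi.\<close>
    have "(\<lambda>n. ((\<Sum>i\<in>J n. \<bar>l n i - c\<bar>) / n) / (real (m n) / n)) \<longlonglongrightarrow>
        ((LINT x|circle_lebesgue. \<bar>Re (f x) - c\<bar>) / (4 * pi)) / (1 / 2)"
      unfolding J_def by (intro tendsto_divide parity_mean_abs_deviation_tendsto[OF basis] m_lim) simp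
    moreover have "((\<Sum>i\<in>J n. \<bar>l n i - c\<bar>) / n) / (real (m n) / n) = (\<Sum>i\<in>J n. \<bar>l n i - c\<bar>) / card (J n)" for n
      by (cases "n = 0") (simp add: J_def, simp add: card)
    ultimately show "(\<lambda>n. (\<Sum>i\<in>J n. \<bar>l n i - c\<bar>) / card (J n)) \<longlonglongrightarrow>
        (LINT x|circle_lebesgue. \<bar>Re (f x) - c\<bar>) / (2 * pi)" by simp
  next
    show "continuous_on UNIV G" unfolding G_def
      by (intro continuous_on_compose2[OF conjunct1[OF F]] continuous_intros) auto
    show "G t = 0" if "\<bar>t\<bar> > B" for t
      by (rule ccontr) (use B[of "of_real (\<sigma> * t)"] that \<sigma> in \<open>auto simp: G_def\<close>)
  qed
  also have "(\<lambda>n. (\<Sum>i\<in>J n. G (l n i)) / of_nat (card (J n))) =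
      (\<lambda>n. 1 / of_nat (size (family_mset (m n) (\<lambda>i. complex_of_real (\<sigma> * l n (p i))))) *
        (\<Sum>z\<in>#family_mset (m n) (\<lambda>i. of_real (\<sigma> * l n (p i))). F z))"
    using sum.reindex_bij_betw[OF bij, of "\<lambda>i. G (l _ i)"]
    by (simp add: fun_eq_iff sum_family_mset card[unfolded J_def] G_def J_def)
  also have "(LINT x|circle_lebesgue. G (Re (f x))) = (LINT x|circle_lebesgue. F (of_real \<sigma> * f x))"
  proof (rule integral_cong_AE)
    show "AE x in circle_lebesgue. G (Re (f x)) = F (of_real \<sigma> * f x)"
      using AE_eq_Re[OF real] by eventually_elim (simp add: G_def)
  qed (auto simp: G_def)
  finally show "(\<lambda>n. 1 / of_nat (size (family_mset (m n) (\<lambda>i. complex_of_real (\<sigma> * l n (p i))))) *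
        (\<Sum>z\<in>#family_mset (m n) (\<lambda>i. of_real (\<sigma> * l n (p i))). F z)) \<longlonglongrightarrow>
      1 / of_real (measure lebesgue {- pi..pi}) * (LINT x|circle_lebesgue. F (of_real \<sigma> * f x))"
    by simp
qed

lemma nat_ceiling_half: "nat \<lceil>real n / 2\<rceil> = (n + 1) div 2"
proof -
  have "\<lceil>real n / 2\<rceil> = int ((n + 1) div 2)"
  proof (rule ceiling_unique)
    have "2 * ((n + 1) div 2) \<le> n + 1" "n \<le> 2 * ((n + 1) div 2)" by presburger+
    then have "2 * real ((n + 1) div 2) \<le> real n + 1" "real n \<le> 2 * real ((n + 1) div 2)" by linarith+
    then show "real_of_int (int ((n + 1) div 2)) - 1 < real n / 2" "real n / 2 \<le> real_of_int (int ((n + 1) div 2))"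
      by simp_all
  qed
  then show ?thesis by simp
qed

lemma nat_floor_half: "nat \<lfloor>real n / 2\<rfloor> = n div 2"
  using floor_divide_of_nat_eq[of n 2, where ?'a = real] by simp

theorem theorem3p1:
  fixes f :: "real \<Rightarrow> complex"
  assumes L1: "integrable (lebesgue_on {-pi..pi}) f"
    and real: "AE x in lebesgue_on {-pi..pi}. f x \<in> \<real>"
    and even: "AE x in lebesgue_on {-pi..pi}. f (- x) = f x"
    and bounded_one_side: "ess_inf_on {0..pi} f > -\<infinity> \<or> ess_sup_on {0..pi} f < \<infinity>"
  shows "\<exists>(V :: nat \<Rightarrow> complex mat) (lamT :: nat \<Rightarrow> nat \<Rightarrow> complex) (lamH :: nat \<Rightarrow> nat \<Rightarrow> complex).
    (\<forall>n. real_unitary_mat n (V n) \<and>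
         eigenvalue_ordering (toeplitz_mat n f) (lamT n) \<and>
         eigenvalue_ordering (flipped_toeplitz_mat n f) (lamH n) \<and>
         (let \<Delta> = diag_from_1 n (\<lambda>i. (-1) ^ (i + 1));
              D = diag_from_1 n (lamT n);
              E = diag_from_1 n (lamH n)
          in exchange_mat n = V n * \<Delta> * mat_adjoint (V n) \<and>
             toeplitz_mat n f = V n * D * mat_adjoint (V n) \<and>
             flipped_toeplitz_mat n f = V n * E * mat_adjoint (V n) \<and>
             E = \<Delta> * D) \<and>
         (\<forall>i\<in>{1..n}. lamH n i = (-1) ^ (i + 1) * lamT n i) \<and>
         family_mset (nat \<lceil>real n / 2\<rceil>) (\<lambda>i. lamH n (2 * i - 1)) =
           family_mset (nat \<lceil>real n / 2\<rceil>) (\<lambda>i. lamT n (2 * i - 1)) \<and>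
         family_mset (nat \<lfloor>real n / 2\<rfloor>) (\<lambda>i. lamH n (2 * i)) =
           family_mset (nat \<lfloor>real n / 2\<rfloor>) (\<lambda>i. - lamT n (2 * i))) \<and>
    asymp_distributed
      (\<lambda>n. family_mset (nat \<lceil>real n / 2\<rceil>) (\<lambda>i. lamH n (2 * i - 1))) {-pi..pi} f \<and>
    asymp_distributed
      (\<lambda>n. family_mset (nat \<lfloor>real n / 2\<rfloor>) (\<lambda>i. lamH n (2 * i))) {-pi..pi} (\<lambda>x. - f x)"
proof -
  \<comment> \<open>One predicate for both properties, so that a single choice over all
    \<open>n\<close> yields \<open>v\<close> and \<open>l\<close>.\<close>
  define Q where "Q n v l \<longleftrightarrow>
      (\<forall>s. s = 1 \<or> s = -1 \<longrightarrow> toeplitz_parity_eigenbasis n (\<lambda>x. Re (f x)) v l s) \<and>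
      (\<forall>j<n. \<forall>k<n. fourier_coeff f (int j - int k) = of_real (\<Sum>i<n. l i * v i j * v i k))" for n v l
  have "\<exists>v l. Q n v l" for n
    unfolding Q_def by (rule ex_toeplitz_parity_eigenbasis[OF L1 real even])
  then obtain v l where Q: "\<And>n. Q n (v n) (l n)" by metis
  have basis: "toeplitz_parity_eigenbasis n (\<lambda>x. Re (f x)) (v n) (l n) s" if "s = 1 \<or> s = -1" for n s
    using Q[of n] that unfolding Q_def by blast
  have coeff: "fourier_coeff f (int j - int k) = of_real (\<Sum>i<n. l n i * v n i j * v n i k)"
    if "j < n" "k < n" for n j k
    using Q[of n] that unfolding Q_def by blast
  note b = basis[of 1, simplified]
  note complete = toeplitz_parity_eigenbasis.complete[OF b]
    and orth = toeplitz_parity_eigenbasis.orthonormal[OF b]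
    and par = toeplitz_parity_eigenbasis.parity[OF b]
  define V where "V n = mat n n (\<lambda>(j, i). complex_of_real (v n i j))" for n
  \<comment> \<open>Eigenvectors are numbered from 0 and eigenvalues from 1, so position
    \<open>i\<close> carries parity (-1)^(i + 1), the sign in the matrix \<Delta>. Position 0 is
    never read.\<close>
  define lamT where "lamT n i = complex_of_real (l n (i - 1))" for n i
  define lamH where "lamH n i = (-1) ^ (i + 1) * lamT n i" for n i
  have adj: "mat_adjoint (V n) = mat n n (\<lambda>(i, j). complex_of_real (v n i j))" for n
    unfolding V_def by (rule mat_adjoint_real)
  have conj: "V n * diag_from_1 n d * mat_adjoint (V n) =
      mat n n (\<lambda>(j, k). \<Sum>i<n. d (i + 1) * of_real (v n i j * v n i k))" for n d
    unfolding adj unfolding V_def by (rule conjugated_diag)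
  have unitary: "real_unitary_mat n (V n)" for n
  proof -
    have AB: "V n \<in> carrier_mat n n" "mat_adjoint (V n) \<in> carrier_mat n n" by (auto simp: adj, simp add: V_def)
    have "V n * mat_adjoint (V n) = 1\<^sub>m n"
      unfolding adj unfolding V_def using complete
      by (intro eq_matI) (auto simp: scalar_prod_def atLeast0LessThan simp flip: of_real_mult of_real_sum)
    moreover have "mat_adjoint (V n) * V n = 1\<^sub>m n" using mat_mult_left_right_inverse[OF AB] calculation by simp
    moreover have "elements_mat (V n) \<subseteq> \<real>" by (auto simp: elements_mat_def V_def)
    ultimately show ?thesis using AB by (simp add: real_unitary_mat_def)
  qed
  have exchange: "exchange_mat n = V n * diag_from_1 n (\<lambda>i. (-1) ^ (i + 1)) * mat_adjoint (V n)" for n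
  proof -
    \<comment> \<open>The sign at position i + 1 is (-1)^i, which multiplies \<open>v n i j\<close>
      to give the entry at n - 1 - j. What remains is the completeness relation with one index
      reflected.\<close>
    have "(\<Sum>i<n. (-1) ^ (i + 1 + 1) * complex_of_real (v n i j * v n i k)) = (if j + k + 1 = n then 1 else 0)"
      if "j < n" "k < n" for j k
    proof -
      have "(\<Sum>i<n. (-1) ^ (i + 1 + 1) * complex_of_real (v n i j * v n i k)) =
          of_real (\<Sum>i<n. v n i (n - 1 - j) * v n i k)"
        unfolding of_real_sum using that
        by (intro sum.cong refl) (simp add: par power_add mult_ac del: One_nat_def diff_diff_left)
      also have "\<dots> = (if n - 1 - j = k then 1 else 0)" using complete[of "n - 1 - j" n k] that by simp
      also have "n - 1 - j = k \<longleftrightarrow> j + k + 1 = n" using that by auto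
      finally show ?thesis .
    qed
    then show ?thesis unfolding conj exchange_mat_def by (intro eq_matI) auto
  qed
  have toeplitz: "toeplitz_mat n f = V n * diag_from_1 n (lamT n) * mat_adjoint (V n)" for n
    unfolding conj toeplitz_mat_def by (intro eq_matI) (auto simp: coeff lamT_def mult_ac)
  have flipped: "flipped_toeplitz_mat n f = V n * diag_from_1 n (lamH n) * mat_adjoint (V n)" for n
  proof -
    have "(\<Sum>m<n. (if j + m + 1 = n then 1 else 0) * fourier_coeff f (int m - int k)) =
        (\<Sum>i<n. lamH n (i + 1) * of_real (v n i j * v n i k))" if "j < n" "k < n" for j k
    proof -
      have "(\<Sum>m<n. (if j + m + 1 = n then 1 else 0) * fourier_coeff f (int m - int k)) =
          (\<Sum>m<n. if m = n - 1 - j then fourier_coeff f (int m - int k) else 0)"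
        using that by (intro sum.cong refl) auto
      \<comment> \<open>Row \<open>j\<close> of the exchange matrix selects row n - 1 - j; parity
        then moves the reflection into the sign of \<open>lamH\<close>.\<close>
      also have "\<dots> = fourier_coeff f (int (n - 1 - j) - int k)" using that by simp
      also have "\<dots> = of_real (\<Sum>i<n. l n i * v n i (n - 1 - j) * v n i k)" using that by (intro coeff) auto
      also have "\<dots> = (\<Sum>i<n. lamH n (i + 1) * of_real (v n i j * v n i k))"
        unfolding of_real_sum using that
        by (intro sum.cong refl) (simp add: par lamH_def lamT_def power_add mult_ac del: One_nat_def diff_diff_left)
      finally show ?thesis .
    qed
    then show ?thesis unfolding conj flipped_toeplitz_mat_def exchange_mat_def toeplitz_mat_def
      by (intro eq_matI) (auto simp: scalar_prod_def atLeast0LessThan)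
  qed
  have diag: "diag_from_1 n (lamH n) = diag_from_1 n (\<lambda>i. (-1) ^ (i + 1)) * diag_from_1 n (lamT n)" for n
    unfolding diag_from_1_def by (simp add: mat_diag_diag lamH_def)
  have odd: "family_mset ((n + 1) div 2) (\<lambda>i. lamH n (2 * i - 1)) =
      family_mset ((n + 1) div 2) (\<lambda>i. of_real (1 * l n (2 * i - 2)))"
    "family_mset ((n + 1) div 2) (\<lambda>i. lamH n (2 * i - 1)) =
      family_mset ((n + 1) div 2) (\<lambda>i. lamT n (2 * i - 1))" for n
  proof -
    have "lamH n (2 * i - 1) = of_real (1 * l n (2 * i - 2))" "lamH n (2 * i - 1) = lamT n (2 * i - 1)"
      if "i \<in> {1..(n + 1) div 2}" for i
      using that by (cases i; simp add: lamH_def lamT_def)+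
    then show "family_mset ((n + 1) div 2) (\<lambda>i. lamH n (2 * i - 1)) =
        family_mset ((n + 1) div 2) (\<lambda>i. of_real (1 * l n (2 * i - 2)))"
      "family_mset ((n + 1) div 2) (\<lambda>i. lamH n (2 * i - 1)) =
        family_mset ((n + 1) div 2) (\<lambda>i. lamT n (2 * i - 1))"
      by (intro family_mset_cong; simp)+
  qed
  have even': "family_mset (n div 2) (\<lambda>i. lamH n (2 * i)) =
      family_mset (n div 2) (\<lambda>i. of_real (- 1 * l n (2 * i - 1)))"
    "family_mset (n div 2) (\<lambda>i. lamH n (2 * i)) = family_mset (n div 2) (\<lambda>i. - lamT n (2 * i))" for n
    by (rule family_mset_cong; simp add: lamH_def lamT_def)+
  \<comment> \<open>Odd positions 2i - 1 hold the eigenvectors with index 2i - 2, the symmetric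
    ones. The inverse i div 2 + 1 fits both parities.\<close>
  have odd_bij: "bij_betw (\<lambda>i. 2 * i - 2) {1..(n + 1) div 2} {i. i < n \<and> (-1) ^ i = (1 :: real)}" for n :: nat
    by (rule bij_betw_byWitness[where f' = "\<lambda>i. i div 2 + 1"])
      (auto simp: minus_one_power_iff split: if_splits elim!: evenE)
  have even_bij: "bij_betw (\<lambda>i. 2 * i - 1) {1..n div 2} {i. i < n \<and> (-1) ^ i = (-1 :: real)}" for n :: nat
    by (rule bij_betw_byWitness[where f' = "\<lambda>i. i div 2 + 1"])
      (auto simp: minus_one_power_iff split: if_splits elim!: oddE)
  have "asymp_distributed (\<lambda>n. family_mset ((n + 1) div 2) (\<lambda>i. of_real (1 * l n (2 * i - 2))))
      {-pi..pi} (\<lambda>x. of_real 1 * f x)"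
    by (rule asymp_distributed_parity_eigenvalues[OF L1 real basis odd_bij]) (simp, linarith, simp)
  \<comment> \<open>On the skew-symmetric eigenvectors the flip changes the sign of the eigenvalue,
    hence -1 and the limit function -f.\<close>
  moreover have "asymp_distributed (\<lambda>n. family_mset (n div 2) (\<lambda>i. of_real (- 1 * l n (2 * i - 1))))
      {-pi..pi} (\<lambda>x. of_real (- 1) * f x)"
    by (rule asymp_distributed_parity_eigenvalues[OF L1 real basis even_bij]) (simp, linarith, simp)
  ultimately have "asymp_distributed (\<lambda>n. family_mset ((n + 1) div 2) (\<lambda>i. lamH n (2 * i - 1))) {-pi..pi} f"
    "asymp_distributed (\<lambda>n. family_mset (n div 2) (\<lambda>i. lamH n (2 * i))) {-pi..pi} (\<lambda>x. - f x)"
    unfolding odd(1) even'(1) by simp_all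
  moreover have "eigenvalue_ordering (toeplitz_mat n f) (lamT n)"
    "eigenvalue_ordering (flipped_toeplitz_mat n f) (lamH n)" for n
    using eigenvalue_ordering_unitary_diag[OF unitary] toeplitz flipped by blast+
  ultimately show ?thesis
    unfolding nat_ceiling_half nat_floor_half Let_def
    by (intro exI[of _ V] exI[of _ lamT] exI[of _ lamH] conjI allI ballI)
      (use unitary exchange toeplitz flipped diag odd(2) even'(2) in \<open>simp_all only: lamH_def\<close>)
qed

end
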